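(* Suppose that $K$ is a (non-trivially) valued field of equi-characteristic $0$ whose theory, in some language $\mathcal L\supset\{+,\cdot,\mathcal O_K\}$, is $0$-h-minimal. Then $K$ is Henselian.
   Context: Valued fields: valuations are arbitrary non-trivial Krull valuations. $K$ has valuation ring $\mathcal O_K\subsetneq K$; equi-characteristic $0$ means that $K$ and its residue field have characteristic $0$. The value group is written multiplicatively, $\Gamma_K^\times=K^\times/\mathcal O_K^\times$, $\Gamma_K=\Gamma_K^\times\cup\{0\}$, with valuation $|\cdot|\colon K\to\Gamma_K$, $|0|=0$, ordered so that $\mathcal O_K=\{x:|x|\le 1\}$. Leading terms: $\mathrm{RV}=K^\times/(1+\{x:|x|<1\})\ \cup\{0\}$ and $\mathrm{rv}\colon K\to\mathrm{RV}$ is the quotient map on $K^\times$ extended by $0\mapsto 0$. Elements of $\mathrm{RV}$ are imaginary elements and may be used as parameters. "$A$-definable" means definable with parameters from $A$. Preparation: a finite non-empty set $C\subset K$ $1$-prepares $X\subset K$ if whether $x\in K$ lies in $X$ depends only on the tuple $(\mathrm{rv}(x-c))_{c\in C}$. $0$-h-minimality: a theory $\mathcal T$ of valued fields of equi-characteristic $0$ in a language containing $\{+,\cdot,\mathcal O_K\}$ is $0$-h-minimal if for every model $K\models\mathcal T$ and every $A\subset K$, every $(A\cup\mathrm{RV})$-definable set $X\subset K$ can be $1$-prepared by a finite $A$-definable set $C\subset K$. *)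

theory Defs
  imports "HOL-Algebra.Polynomials"
begin

section \<open>First-order logic\<close>

datatype 'f tm = Var nat | Fun 'f "'f tm list"

datatype ('f, 'r) form =
    Eq "'f tm" "'f tm"
  | Rel 'r "'f tm list"
  | Neg "('f, 'r) form"
  | Conj "('f, 'r) form" "('f, 'r) form"
  | All nat "('f, 'r) form"

text \<open>
  The symbols of a language are all elements of the types \<open>'f\<close> and \<open>'r\<close>. Three of them
  are singled out, for addition, multiplication and the valuation ring; the others are arbitrary.
\<close>

record ('f, 'r) vlang =
  fun_arity :: "'f \<Rightarrow> nat"
  rel_arity :: "'r \<Rightarrow> nat"
  add_sym :: 'f
  mul_sym :: 'f
  val_sym :: 'r

definition valued_language :: "('f, 'r) vlang \<Rightarrow> bool" where
  "valued_language L \<longleftrightarrow>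
     add_sym L \<noteq> mul_sym L \<and> fun_arity L (add_sym L) = 2 \<and> fun_arity L (mul_sym L) = 2 \<and>
     rel_arity L (val_sym L) = 1"

fun wf_tm :: "('f, 'r) vlang \<Rightarrow> 'f tm \<Rightarrow> bool" where
  "wf_tm L (Var i) \<longleftrightarrow> True"
| "wf_tm L (Fun f ts) \<longleftrightarrow> length ts = fun_arity L f \<and> (\<forall>t\<in>set ts. wf_tm L t)"

fun wf_form :: "('f, 'r) vlang \<Rightarrow> ('f, 'r) form \<Rightarrow> bool" where
  "wf_form L (Eq s t) \<longleftrightarrow> wf_tm L s \<and> wf_tm L t"
| "wf_form L (Rel r ts) \<longleftrightarrow> length ts = rel_arity L r \<and> (\<forall>t\<in>set ts. wf_tm L t)"
| "wf_form L (Neg \<phi>) \<longleftrightarrow> wf_form L \<phi>"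
| "wf_form L (Conj \<phi> \<psi>) \<longleftrightarrow> wf_form L \<phi> \<and> wf_form L \<psi>"
| "wf_form L (All i \<phi>) \<longleftrightarrow> wf_form L \<phi>"

fun fv_tm :: "'f tm \<Rightarrow> nat set" where
  "fv_tm (Var i) = {i}"
| "fv_tm (Fun f ts) = (\<Union>t\<in>set ts. fv_tm t)"

fun fv :: "('f, 'r) form \<Rightarrow> nat set" where
  "fv (Eq s t) = fv_tm s \<union> fv_tm t"
| "fv (Rel r ts) = (\<Union>t\<in>set ts. fv_tm t)"
| "fv (Neg \<phi>) = fv \<phi>"
| "fv (Conj \<phi> \<psi>) = fv \<phi> \<union> fv \<psi>"
| "fv (All i \<phi>) = fv \<phi> - {i}"

record ('f, 'r, 'u) struct =
  universe :: "'u set"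
  fun_int :: "'f \<Rightarrow> 'u list \<Rightarrow> 'u"
  rel_int :: "'r \<Rightarrow> 'u list \<Rightarrow> bool"

definition is_structure :: "('f, 'r) vlang \<Rightarrow> ('f, 'r, 'u) struct \<Rightarrow> bool" where
  "is_structure L M \<longleftrightarrow>
     universe M \<noteq> {} \<and>
     (\<forall>f xs. length xs = fun_arity L f \<and> set xs \<subseteq> universe M \<longrightarrow> fun_int M f xs \<in> universe M)"

fun tm_val :: "('f, 'r, 'u) struct \<Rightarrow> (nat \<Rightarrow> 'u) \<Rightarrow> 'f tm \<Rightarrow> 'u" where
  "tm_val M v (Var i) = v i"
| "tm_val M v (Fun f ts) = fun_int M f (map (tm_val M v) ts)"

fun sat :: "('f, 'r, 'u) struct \<Rightarrow> (nat \<Rightarrow> 'u) \<Rightarrow> ('f, 'r) form \<Rightarrow> bool" where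
  "sat M v (Eq s t) \<longleftrightarrow> tm_val M v s = tm_val M v t"
| "sat M v (Rel r ts) \<longleftrightarrow> rel_int M r (map (tm_val M v) ts)"
| "sat M v (Neg \<phi>) \<longleftrightarrow> \<not> sat M v \<phi>"
| "sat M v (Conj \<phi> \<psi>) \<longleftrightarrow> sat M v \<phi> \<and> sat M v \<psi>"
| "sat M v (All i \<phi>) \<longleftrightarrow> (\<forall>x\<in>universe M. sat M (v(i := x)) \<phi>)"

definition sentences :: "('f, 'r) vlang \<Rightarrow> ('f, 'r) form set" where
  "sentences L = {\<phi>. wf_form L \<phi> \<and> fv \<phi> = {}}"

definition is_model :: "('f, 'r) vlang \<Rightarrow> ('f, 'r) form set \<Rightarrow> ('f, 'r, 'u) struct \<Rightarrow> bool" where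
  "is_model L T M \<longleftrightarrow> is_structure L M \<and> (\<forall>\<phi>\<in>T. \<forall>v. sat M v \<phi>)"

definition theory_of :: "('f, 'r) vlang \<Rightarrow> ('f, 'r, 'u) struct \<Rightarrow> ('f, 'r) form set" where
  "theory_of L M = {\<phi> \<in> sentences L. \<forall>v. sat M v \<phi>}"

text \<open>
  Parameters may be imaginary elements, that is, equivalence classes (here: subsets of the
  universe); the ordinary element \<open>a\<close> is the class \<open>{a}\<close>. A formula is evaluated at imaginary
  parameters by inserting representatives, and the set that it defines must not depend on
  their choice. The variable 0 is the one that ranges over the defined set.
\<close>

definition definable ::
    "('f, 'r) vlang \<Rightarrow> ('f, 'r, 'u) struct \<Rightarrow> 'u set set \<Rightarrow> 'u set \<Rightarrow> bool" where
  "definable L M B D \<longleftrightarrow>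
     (\<exists>\<phi> p. wf_form L \<phi> \<and> (\<forall>i\<in>fv \<phi> - {0}. p i \<in> B) \<and>
        (\<forall>v. (\<forall>i\<in>fv \<phi> - {0}. v i \<in> p i) \<longrightarrow> D = {x \<in> universe M. sat M (v(0 := x)) \<phi>}))"

definition elements :: "'u set \<Rightarrow> 'u set set" where
  "elements A = (\<lambda>a. {a}) ` A"


section \<open>Valued fields\<close>

text \<open>
  The constants 0 and 1 need not be symbols of the language, so they are recovered from the
  operations.
\<close>

definition ring_of :: "('f, 'r) vlang \<Rightarrow> ('f, 'r, 'u) struct \<Rightarrow> 'u ring" where
  "ring_of L M =
     \<lparr>carrier = universe M,
      mult = (\<lambda>x y. fun_int M (mul_sym L) [x, y]),
      one = (THE e. e \<in> universe M \<and> (\<forall>x\<in>universe M. fun_int M (mul_sym L) [e, x] = x)),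
      zero = (THE z. z \<in> universe M \<and> (\<forall>x\<in>universe M. fun_int M (add_sym L) [z, x] = x)),
      add = (\<lambda>x y. fun_int M (add_sym L) [x, y])\<rparr>"

definition val_ring :: "('f, 'r) vlang \<Rightarrow> ('f, 'r, 'u) struct \<Rightarrow> 'u set" where
  "val_ring L M = {x \<in> universe M. rel_int M (val_sym L) [x]}"

text \<open>
  For the valuation \<open>|.|\<close> with values in \<open>K\<^sup>\<times> / O\<^sup>\<times> \<union> {0}\<close>, the relation \<open>val_le\<close> says
  \<open>|x| \<le> |y|\<close>, i.e. \<open>x \<in> y O\<close>.
\<close>

definition val_le :: "('f, 'r) vlang \<Rightarrow> ('f, 'r, 'u) struct \<Rightarrow> 'u \<Rightarrow> 'u \<Rightarrow> bool" where
  "val_le L M x y \<longleftrightarrow> (\<exists>c\<in>val_ring L M. x = y \<otimes>\<^bsub>ring_of L M\<^esub> c)"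

definition val_less :: "('f, 'r) vlang \<Rightarrow> ('f, 'r, 'u) struct \<Rightarrow> 'u \<Rightarrow> 'u \<Rightarrow> bool" where
  "val_less L M x y \<longleftrightarrow> val_le L M x y \<and> \<not> val_le L M y x"

definition val_eq :: "('f, 'r) vlang \<Rightarrow> ('f, 'r, 'u) struct \<Rightarrow> 'u \<Rightarrow> 'u \<Rightarrow> bool" where
  "val_eq L M x y \<longleftrightarrow> val_le L M x y \<and> val_le L M y x"

definition max_ideal :: "('f, 'r) vlang \<Rightarrow> ('f, 'r, 'u) struct \<Rightarrow> 'u set" where
  "max_ideal L M = {x \<in> universe M. val_less L M x \<one>\<^bsub>ring_of L M\<^esub>}"

definition residue_field :: "('f, 'r) vlang \<Rightarrow> ('f, 'r, 'u) struct \<Rightarrow> 'u set ring" where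
  "residue_field L M = (ring_of L M)\<lparr>carrier := val_ring L M\<rparr> Quot max_ideal L M"

definition char_zero :: "('u, 'm) ring_scheme \<Rightarrow> bool" where
  "char_zero R \<longleftrightarrow> (\<forall>n::nat. n > 0 \<longrightarrow> [n] \<cdot>\<^bsub>R\<^esub> \<one>\<^bsub>R\<^esub> \<noteq> \<zero>\<^bsub>R\<^esub>)"

definition valued_field :: "('f, 'r) vlang \<Rightarrow> ('f, 'r, 'u) struct \<Rightarrow> bool" where
  "valued_field L M \<longleftrightarrow>
     field (ring_of L M) \<and>
     subring (val_ring L M) (ring_of L M) \<and>
     (\<forall>x \<in> universe M - {\<zero>\<^bsub>ring_of L M\<^esub>}. x \<in> val_ring L M \<or> inv\<^bsub>ring_of L M\<^esub> x \<in> val_ring L M) \<and>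
     val_ring L M \<noteq> universe M"

definition equichar0_valued_field :: "('f, 'r) vlang \<Rightarrow> ('f, 'r, 'u) struct \<Rightarrow> bool" where
  "equichar0_valued_field L M \<longleftrightarrow>
     valued_field L M \<and> char_zero (ring_of L M) \<and> char_zero (residue_field L M)"

text \<open>The coset of 0 is \<open>{0}\<close>, which serves as the extra element 0 of RV.\<close>

definition rv :: "('f, 'r) vlang \<Rightarrow> ('f, 'r, 'u) struct \<Rightarrow> 'u \<Rightarrow> 'u set" where
  "rv L M x = x <#\<^bsub>ring_of L M\<^esub> (\<one>\<^bsub>ring_of L M\<^esub> <+\<^bsub>ring_of L M\<^esub> max_ideal L M)"

definition RV :: "('f, 'r) vlang \<Rightarrow> ('f, 'r, 'u) struct \<Rightarrow> 'u set set" where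
  "RV L M = rv L M ` universe M"


section \<open>0-h-minimality\<close>

definition one_prepares ::
    "('f, 'r) vlang \<Rightarrow> ('f, 'r, 'u) struct \<Rightarrow> 'u set \<Rightarrow> 'u set \<Rightarrow> bool" where
  "one_prepares L M C D \<longleftrightarrow>
     finite C \<and> C \<noteq> {} \<and> C \<subseteq> universe M \<and> D \<subseteq> universe M \<and>
     (\<forall>x\<in>universe M. \<forall>y\<in>universe M.
        (\<forall>c\<in>C. rv L M (x \<ominus>\<^bsub>ring_of L M\<^esub> c) = rv L M (y \<ominus>\<^bsub>ring_of L M\<^esub> c)) \<longrightarrow>
        (x \<in> D \<longleftrightarrow> y \<in> D))"

text \<open>
  A formula cannot quantify over all types, so the models range over all structures whose
  universe is a subset of a given type \<open>'u\<close>. This is no restriction once the cardinality of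
  \<open>'u\<close> is at least the number of formulas: if some model, of any size, violates one of the
  conditions below for some set \<open>D\<close>, defined by a formula with finitely many parameters, then by
  the downward Loewenheim-Skolem theorem so does an elementary submodel that contains these
  parameters (or representatives of them) and has at most as many elements as there are formulas.
\<close>

definition zero_h_minimal ::
    "'u itself \<Rightarrow> ('f, 'r) vlang \<Rightarrow> ('f, 'r) form set \<Rightarrow> bool" where
  "zero_h_minimal U L T \<longleftrightarrow>
     T \<subseteq> sentences L \<and>
     (\<forall>M :: ('f, 'r, 'u) struct. is_model L T M \<longrightarrow>
        equichar0_valued_field L M \<and>
        (\<forall>A D. A \<subseteq> universe M \<and> definable L M (elements A \<union> RV L M) D \<longrightarrow>
           (\<exists>C. definable L M (elements A) C \<and> one_prepares L M C D)))"

text \<open>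
  A type that is large enough in this sense: the sets of formulas with names for the elements
  of \<open>'a\<close>. It also contains a copy of every structure with universe in \<open>'a\<close>.
\<close>

type_synonym ('f, 'r, 'a) model_universe = "('f + 'a, 'r) form set"


section \<open>Henselian valued fields\<close>

text \<open>
  Polynomials are the coefficient lists of \<^theory>\<open>HOL-Algebra.Polynomials\<close>, with the leading
  coefficient first.
\<close>

fun poly_deriv :: "('u, 'm) ring_scheme \<Rightarrow> 'u list \<Rightarrow> 'u list" where
  "poly_deriv R [] = []"
| "poly_deriv R [a] = []"
| "poly_deriv R (a # b # p) = ([Suc (length p)] \<cdot>\<^bsub>R\<^esub> a) # poly_deriv R (b # p)"

definition henselian :: "('f, 'r) vlang \<Rightarrow> ('f, 'r, 'u) struct \<Rightarrow> bool" where
  "henselian L M \<longleftrightarrow>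
     valued_field L M \<and>
     (\<forall>P \<in> carrier (univ_poly (ring_of L M) (val_ring L M)). \<forall>a \<in> val_ring L M.
        val_less L M (ring.eval (ring_of L M) P a) \<one>\<^bsub>ring_of L M\<^esub> \<and>
        val_eq L M (ring.eval (ring_of L M) (poly_deriv (ring_of L M) P) a) \<one>\<^bsub>ring_of L M\<^esub> \<longrightarrow>
        (\<exists>b \<in> val_ring L M. ring.eval (ring_of L M) P b = \<zero>\<^bsub>ring_of L M\<^esub> \<and>
           val_less L M (b \<ominus>\<^bsub>ring_of L M\<^esub> a) \<one>\<^bsub>ring_of L M\<^esub>))"

end

theory Submission
  imports Defs
begin

text \<open>
  Suppose that Hensel's lemma fails for a polynomial \<open>p\<close> and an approximate root \<open>a\<close>. On the open
  ball \<open>|x - a| < 1\<close> the map \<open>p\<close> is an isometry, and Newton's step strictly decreases \<open>|p(x)|\<close>, so the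
  sets \<open>{x. |p(x)| < |p(y)|}\<close> form a chain of non-empty sets. Take an ultrafilter on \<open>K\<close> that contains
  all of them. In the ultrapower \<open>U\<close> of \<open>K\<close>, the class \<open>\<delta>\<close> of the identity satisfies
  \<open>0 < |p(\<delta>)| < |p(y)|\<close> for all \<open>y \<in> K\<close> in the ball. The set \<open>D = {x. |p(x)| \<le> |p(\<delta>)|}\<close> is definable
  over \<open>K \<union> {rv (p(\<delta>))}\<close>, so it is 1-prepared by a finite \<open>K\<close>-definable set \<open>C\<close>, which lies in \<open>K\<close>
  because \<open>K\<close> is an elementary submodel. Choose \<open>y \<in> K\<close> in the ball with \<open>|p(y)| < |p(c)|\<close> for all
  \<open>c \<in> C\<close> in the ball. Then \<open>|y - \<delta>| < |\<delta> - c|\<close>, that is \<open>rv (y - c) = rv (\<delta> - c)\<close>, for all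
  \<open>c \<in> C\<close>, but \<open>\<delta> \<in> D\<close> and \<open>y \<notin> D\<close>.
\<close>

section \<open>Ultrapowers\<close>

lemma tm_val_cong: "(\<And>i. i \<in> fv_tm t \<Longrightarrow> v i = w i) \<Longrightarrow> tm_val M v t = tm_val M w t"
proof (induction t)
  case (Fun f ts)
  then have "map (tm_val M v) ts = map (tm_val M w) ts" by auto
  then show ?case by (simp only: tm_val.simps)
qed simp

lemma sat_cong: "(\<And>i. i \<in> fv \<phi> \<Longrightarrow> v i = w i) \<Longrightarrow> sat M v \<phi> = sat M w \<phi>"
proof (induction \<phi> arbitrary: v w)
  case (Eq s t)
  then show ?case using tm_val_cong[of s v w M] tm_val_cong[of t v w M] by simp
next
  case (Rel r ts)
  then have "map (tm_val M v) ts = map (tm_val M w) ts"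
    by (auto intro!: tm_val_cong)
  then show ?case by (simp only: sat.simps)
next
  case (Neg \<phi>)
  show ?case using Neg.IH[of v w] Neg.prems by simp
next
  case (Conj \<phi> \<psi>)
  show ?case using Conj.IH(1)[of v w] Conj.IH(2)[of v w] Conj.prems by simp
next
  case (All n \<phi>)
  have "sat M (v(n := x)) \<phi> = sat M (w(n := x)) \<phi>" for x
    by (rule All.IH) (use All.prems in auto)
  then show ?case by simp
qed

lemma tm_val_closed:
  assumes "is_structure L M" and "\<And>i. v i \<in> universe M" and "wf_tm L t"
  shows "tm_val M v t \<in> universe M"
  using assms(3)
proof (induction t)
  case (Fun f ts)
  then show ?case using assms(1) unfolding is_structure_def by (auto simp: image_subset_iff)
qed (simp add: assms(2))

section \<open>Ultrafilters\<close>

definition ultra :: "'i filter \<Rightarrow> bool" where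
  "ultra F \<longleftrightarrow> F \<noteq> bot \<and> (\<forall>P. eventually P F \<or> eventually (\<lambda>x. \<not> P x) F)"

lemma ultra_not: "ultra F \<Longrightarrow> eventually (\<lambda>x. \<not> P x) F \<longleftrightarrow> \<not> eventually P F"
  using not_eventually_impI[of P F "\<lambda>_. False"] unfolding ultra_def trivial_limit_def by auto

text \<open>If no single \<open>s\<close> worked, each \<open>P s\<close> would eventually fail, and
  finitely many failures would combine against properness. With \<open>P s x\<close> saying
  \<open>g x = s\<close>, a sequence that eventually lies in a finite set is eventually
  constant.\<close>

lemma ultra_bex_finite:
  assumes "ultra F" and "finite S" and "eventually (\<lambda>x. \<exists>s\<in>S. P s x) F"
  shows "\<exists>s\<in>S. eventually (P s) F"
proof (rule ccontr)
  assume "\<not> ?thesis"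
  then have "\<forall>s\<in>S. eventually (\<lambda>x. \<not> P s x) F"
    using ultra_not[OF assms(1)] by blast
  then have "eventually (\<lambda>x. \<forall>s\<in>S. \<not> P s x) F"
    using assms(2) by (simp add: eventually_ball_finite)
  with assms(3) have "eventually (\<lambda>x. False) F"
    by eventually_elim blast
  with assms(1) show False by (simp add: ultra_def)
qed

text \<open>Zorn's lemma for the proper filters below \<open>F\<close> with the order reversed:
  \<open>G \<le> H\<close> means that \<open>G\<close> is finer, so an ultrafilter is a minimal
  element.\<close>

lemma ultrafilter_exists:
  fixes F :: "'i filter"
  assumes "F \<noteq> bot"
  obtains G where "G \<le> F" and "ultra G"
proof -
  let ?A = "{G. G \<noteq> bot \<and> G \<le> F}"
  have "\<exists>m\<in>?A. \<forall>a\<in>?A. m \<ge> a \<longrightarrow> a = m"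
  proof (rule predicate_Zorn[where P = "(\<ge>)"])
    show "partial_order_on ?A (relation_of (\<ge>) ?A)"
      by (rule partial_order_on_relation_ofI) auto
  next
    fix C assume C: "C \<in> Chains (relation_of (\<ge>) ?A)"
    then have sub: "C \<subseteq> ?A"
      by (auto simp: Chains_def relation_of_def)
    have chain: "G \<le> H \<or> H \<le> G" if "G \<in> C" "H \<in> C" for G H
      using that C by (auto simp: Chains_def relation_of_def)
    have ne: "\<not> eventually (\<lambda>x. False) G" if "G \<in> C" for G
      using sub that by (auto simp: trivial_limit_def)
    show "\<exists>u\<in>?A. \<forall>a\<in>C. u \<le> a"
    proof (cases "C = {}")
      case True
      then show ?thesis using assms by auto
    next
      case False
      then obtain G where G: "G \<in> C" by blast
      \<comment> \<open>A chain is directed downwards, so what holds eventually for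
        \<open>Inf C\<close> does so already for some member of \<open>C\<close>, and all members
        are proper.\<close>
      have "Inf C \<noteq> bot"
        unfolding trivial_limit_def
      proof (subst eventually_Inf_base[OF False])
        show "\<exists>x\<in>C. x \<le> inf G H" if "G \<in> C" "H \<in> C" for G H
          using that chain[OF that] by auto
      qed (use ne in blast)
      moreover have "Inf C \<le> F"
        using G sub by (blast intro: Inf_lower order_trans)
      ultimately show ?thesis by (auto intro: Inf_lower)
    qed
  qed
  then obtain G where G: "G \<noteq> bot" "G \<le> F"
    and max: "\<And>H. H \<noteq> bot \<Longrightarrow> H \<le> G \<Longrightarrow> H = G"
    by (blast intro: order_trans)
  have "eventually P G \<or> eventually (\<lambda>x. \<not> P x) G" for P
  proof (cases "eventually (\<lambda>x. \<not> P x) G")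
    case False
    \<comment> \<open>Restricting \<open>G\<close> to the points that satisfy \<open>P\<close> keeps
      it proper, so by minimality the restriction is \<open>G\<close> itself.\<close>
    then have "inf G (principal {x. P x}) \<noteq> bot"
      by (simp add: trivial_limit_def eventually_inf_principal)
    then have "inf G (principal {x. P x}) = G" by (intro max) auto
    then have "G \<le> principal {x. P x}" by (metis inf_le2)
    then show ?thesis by (simp add: le_principal)
  qed simp
  with G show ?thesis using that by (auto simp: ultra_def)
qed

section \<open>Ultrapowers and Los's theorem\<close>

definition seqs :: "('f, 'r, 'a) struct \<Rightarrow> ('i \<Rightarrow> 'a) set" where
  "seqs K = {g. \<forall>i. g i \<in> universe K}"

text \<open>The type of classes is left open: \<open>cls\<close> is any map that identifies
  sequences exactly when they agree modulo \<open>F\<close>. The ultrapower can thus be placed in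
  the type over which \<open>zero_h_minimal\<close> quantifies.\<close>

locale ultrapower =
  fixes L :: "('f, 'r) vlang" and K :: "('f, 'r, 'a) struct"
    and F :: "'i filter" and cls :: "('i \<Rightarrow> 'a) \<Rightarrow> 'u"
  assumes struct_K: "is_structure L K"
    and ultra_F: "ultra F"
    and cls_eq_iff: "\<And>g h. g \<in> seqs K \<Longrightarrow> h \<in> seqs K \<Longrightarrow> cls g = cls h \<longleftrightarrow> eventually (\<lambda>i. g i = h i) F"
begin

definition rep :: "'u \<Rightarrow> 'i \<Rightarrow> 'a" where
  "rep x = (SOME g. g \<in> seqs K \<and> cls g = x)"

text \<open>Functions and relations are evaluated at the representatives chosen by
  \<open>rep\<close>; for functions, \<open>fun_int_upow\<close> shows that any other
  representatives give the same class.\<close>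

definition upow :: "('f, 'r, 'u) struct" where
  "upow = \<lparr>universe = cls ` seqs K,
     fun_int = (\<lambda>f xs. cls (\<lambda>i. fun_int K f (map (\<lambda>x. rep x i) xs))),
     rel_int = (\<lambda>r xs. eventually (\<lambda>i. rel_int K r (map (\<lambda>x. rep x i) xs)) F)\<rparr>"

lemma universe_upow [simp]: "universe upow = cls ` seqs K"
  by (simp add: upow_def)

lemma rep_cls:
  assumes "g \<in> seqs K"
  shows "rep (cls g) \<in> seqs K" and "eventually (\<lambda>i. rep (cls g) i = g i) F"
proof -
  have *: "rep (cls g) \<in> seqs K \<and> cls (rep (cls g)) = cls g"
    unfolding rep_def by (rule someI[of _ g]) (use assms in simp)
  then show "rep (cls g) \<in> seqs K" ..
  then show "eventually (\<lambda>i. rep (cls g) i = g i) F"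
    using * assms cls_eq_iff by blast
qed

text \<open>An argument list is finite, so the chosen representatives agree with the given ones at
  all places simultaneously, for almost all indices.\<close>

lemma eventually_map_rep:
  assumes "\<And>x. x \<in> set xs \<Longrightarrow> G x \<in> seqs K"
  shows "eventually (\<lambda>i. map (\<lambda>x. rep x i) (map (\<lambda>x. cls (G x)) xs) = map (\<lambda>x. G x i) xs) F"
proof -
  have "eventually (\<lambda>i. \<forall>x\<in>set xs. rep (cls (G x)) i = G x i) F"
    using assms rep_cls(2) by (auto intro: eventually_ball_finite)
  then show ?thesis by eventually_elim auto
qed

lemma fun_int_seqs:
  assumes "length xs = fun_arity L f" and "\<And>x. x \<in> set xs \<Longrightarrow> G x \<in> seqs K"
  shows "(\<lambda>i. fun_int K f (map (\<lambda>x. G x i) xs)) \<in> seqs K"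
  using assms struct_K by (auto simp: seqs_def is_structure_def image_subset_iff)

lemma fun_int_upow:
  assumes "length xs = fun_arity L f" and "\<And>x. x \<in> set xs \<Longrightarrow> G x \<in> seqs K"
  shows "fun_int upow f (map (\<lambda>x. cls (G x)) xs) = cls (\<lambda>i. fun_int K f (map (\<lambda>x. G x i) xs))"
proof -
  have "(\<lambda>i. fun_int K f (map (\<lambda>x. rep x i) (map (\<lambda>x. cls (G x)) xs))) \<in> seqs K"
    using fun_int_seqs[of xs f "\<lambda>x. rep (cls (G x))"] assms by (simp add: rep_cls(1) comp_def)
  moreover have "eventually (\<lambda>i. fun_int K f (map (\<lambda>x. rep x i) (map (\<lambda>x. cls (G x)) xs))
      = fun_int K f (map (\<lambda>x. G x i) xs)) F"
    by (rule eventually_mono[OF eventually_map_rep[of xs G]]) (simp_all only: assms(2))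
  ultimately show ?thesis
    unfolding upow_def using cls_eq_iff fun_int_seqs[of xs f G] assms by simp
qed

lemma is_structure_upow: "is_structure L upow"
proof -
  obtain a where "a \<in> universe K"
    using struct_K by (auto simp: is_structure_def)
  then have "(\<lambda>_. a) \<in> seqs K" by (simp add: seqs_def)
  moreover have "fun_int upow f xs \<in> universe upow"
    if "length xs = fun_arity L f" "set xs \<subseteq> universe upow" for f xs
  proof -
    have "rep x \<in> seqs K" "cls (rep x) = x" if x: "x \<in> set xs" for x
    proof -
      obtain g where g: "g \<in> seqs K" "x = cls g" using x \<open>set xs \<subseteq> _\<close> by auto
      then show "rep x \<in> seqs K" "cls (rep x) = x"
        using rep_cls[OF g(1)] cls_eq_iff by auto
    qed
    then have "(\<lambda>i. fun_int K f (map (\<lambda>x. rep x i) xs)) \<in> seqs K"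
      using that by (intro fun_int_seqs) auto
    then show ?thesis by (simp add: upow_def)
  qed
  ultimately show ?thesis unfolding is_structure_def by auto
qed

lemma tm_val_seqs:
  assumes "\<And>n. v n \<in> seqs K" and "wf_tm L t"
  shows "(\<lambda>i. tm_val K (\<lambda>n. v n i) t) \<in> seqs K"
  using assms tm_val_closed[OF struct_K] by (auto simp: seqs_def)

lemma tm_val_upow:
  assumes "\<And>n. v n \<in> seqs K" and "wf_tm L t"
  shows "tm_val upow (\<lambda>n. cls (v n)) t = cls (\<lambda>i. tm_val K (\<lambda>n. v n i) t)"
  using assms(2)
proof (induction t)
  case (Fun f ts)
  have "map (tm_val upow (\<lambda>n. cls (v n))) ts = map (\<lambda>t. cls (\<lambda>i. tm_val K (\<lambda>n. v n i) t)) ts"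
    using Fun by simp
  moreover have "fun_int upow f (map (\<lambda>t. cls (\<lambda>i. tm_val K (\<lambda>n. v n i) t)) ts)
      = cls (\<lambda>i. fun_int K f (map (\<lambda>t. tm_val K (\<lambda>n. v n i) t) ts))"
    using Fun.prems assms(1) by (intro fun_int_upow tm_val_seqs) auto
  ultimately show ?case by (simp only: tm_val.simps)
qed simp

text \<open>Induction on \<open>\<phi>\<close>. Negation is where \<open>F\<close> has to be an
  ultrafilter; the quantifier needs a choice of counterexamples.\<close>

lemma los_theorem:
  assumes "\<And>n. v n \<in> seqs K" and "wf_form L \<phi>"
  shows "sat upow (\<lambda>n. cls (v n)) \<phi> \<longleftrightarrow> eventually (\<lambda>i. sat K (\<lambda>n. v n i) \<phi>) F"
  using assms
proof (induction \<phi> arbitrary: v)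
  case (Eq s t)
  then show ?case by (simp add: tm_val_upow tm_val_seqs cls_eq_iff)
next
  case (Rel r ts)
  have *: "map (tm_val upow (\<lambda>n. cls (v n))) ts = map (\<lambda>t. cls (\<lambda>i. tm_val K (\<lambda>n. v n i) t)) ts"
    using Rel by (simp add: tm_val_upow)
  have "eventually (\<lambda>i. map (\<lambda>x. rep x i) (map (\<lambda>t. cls (\<lambda>i. tm_val K (\<lambda>n. v n i) t)) ts)
      = map (\<lambda>t. tm_val K (\<lambda>n. v n i) t) ts) F"
    using Rel by (intro eventually_map_rep tm_val_seqs) auto
  then have "eventually (\<lambda>i. rel_int K r (map (\<lambda>x. rep x i) (map (\<lambda>t. cls (\<lambda>i. tm_val K (\<lambda>n. v n i) t)) ts))
      \<longleftrightarrow> rel_int K r (map (tm_val K (\<lambda>n. v n i)) ts)) F"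
    by (rule eventually_mono) (simp only:)
  then show ?case
    unfolding sat.simps * by (simp add: upow_def) (rule eventually_subst)
next
  case (Neg \<phi>)
  then show ?case by (simp add: ultra_not[OF ultra_F])
next
  case (Conj \<phi> \<psi>)
  then show ?case by (simp add: eventually_conj_iff)
next
  case (All n \<phi>)
  \<comment> \<open>Updating the assignment by a class amounts to updating the family of sequences
    by a representative, to which the induction hypothesis applies.\<close>
  have upd: "sat upow ((\<lambda>m. cls (v m))(n := cls g)) \<phi> \<longleftrightarrow> eventually (\<lambda>i. sat K ((\<lambda>m. v m i)(n := g i)) \<phi>) F"
    if "g \<in> seqs K" for g
  proof -
    have "(\<lambda>m. cls (v m))(n := cls g) = (\<lambda>m. cls ((v(n := g)) m))"
      and "(\<lambda>m. v m i)(n := g i) = (\<lambda>m. (v(n := g)) m i)" for i by auto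
    then show ?thesis using All that by (simp only:) (rule All.IH, auto)
  qed
  show ?case
  proof
    assume L: "sat upow (\<lambda>n. cls (v n)) (All n \<phi>)"
    \<comment> \<open>\<open>g i\<close> will be a counterexample at index \<open>i\<close> if there
      is one, and any element otherwise. So the instance at \<open>g\<close> implies the universal
      statement at each index.\<close>
    have "\<exists>x\<in>universe K. sat K ((\<lambda>m. v m i)(n := x)) \<phi> \<longrightarrow> sat K (\<lambda>m. v m i) (All n \<phi>)" for i
      using struct_K by (cases "sat K (\<lambda>m. v m i) (All n \<phi>)") (auto simp: is_structure_def simp del: not_all)
    then obtain g where g: "\<And>i. g i \<in> universe K"
      "\<And>i. sat K ((\<lambda>m. v m i)(n := g i)) \<phi> \<longrightarrow> sat K (\<lambda>m. v m i) (All n \<phi>)"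
      by metis
    then have "g \<in> seqs K" by (simp add: seqs_def)
    with L have "eventually (\<lambda>i. sat K ((\<lambda>m. v m i)(n := g i)) \<phi>) F"
      using upd by auto
    then show "eventually (\<lambda>i. sat K (\<lambda>m. v m i) (All n \<phi>)) F"
      by (rule eventually_mono) (use g(2) in blast)
  next
    assume R: "eventually (\<lambda>i. sat K (\<lambda>m. v m i) (All n \<phi>)) F"
    have "sat upow ((\<lambda>m. cls (v m))(n := cls g)) \<phi>" if "g \<in> seqs K" for g
      using R unfolding upd[OF that]
      by (rule eventually_mono) (use that in \<open>auto simp: seqs_def\<close>)
    then show "sat upow (\<lambda>n. cls (v n)) (All n \<phi>)" by auto
  qed
qed

lemma is_model_upow: "is_model L (theory_of L K) upow"
  unfolding is_model_def
proof (intro conjI ballI allI)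
  fix \<phi> :: "('f, 'r) form" and w :: "nat \<Rightarrow> 'u"
  assume "\<phi> \<in> theory_of L K"
  then have \<phi>: "wf_form L \<phi>" "fv \<phi> = {}" "\<And>v. sat K v \<phi>"
    by (auto simp: theory_of_def sentences_def)
  \<comment> \<open>The assignment \<open>w\<close> may leave the universe, so truth is shown for a
    constant assignment and transferred by \<open>sat_cong\<close>.\<close>
  obtain a where "a \<in> universe K"
    using struct_K by (auto simp: is_structure_def)
  then have "sat upow (\<lambda>n. cls (\<lambda>_. a)) \<phi>"
    using los_theorem[of "\<lambda>_ _. a" \<phi>] \<phi> by (simp add: seqs_def)
  then show "sat upow w \<phi>"
    using sat_cong[of \<phi> w "\<lambda>n. cls (\<lambda>_. a)" upow] \<phi>(2) by simp
qed (rule is_structure_upow)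

section \<open>The diagonal embedding and finite definable sets\<close>

definition diag :: "'a \<Rightarrow> 'u" where
  "diag a = cls (\<lambda>_. a)"

text \<open>The formula that defines \<open>C\<close> also defines a set \<open>S\<close> in
  \<open>K\<close>, and by Los's theorem \<open>cls g\<close> is in \<open>C\<close> iff
  \<open>g\<close> is eventually in \<open>S\<close>. As \<open>diag\<close> is injective,
  finiteness passes from \<open>C\<close> to \<open>S\<close>, and then each class in
  \<open>C\<close> is that of a constant sequence.\<close>

lemma finite_definable_diag:
  assumes "definable L upow (elements A) C" and "A \<subseteq> diag ` universe K" and "finite C"
  shows "\<exists>S. finite S \<and> S \<subseteq> universe K \<and> C = diag ` S"
proof -
  obtain \<phi> p where \<phi>: "wf_form L \<phi>" and p: "\<forall>i\<in>fv \<phi> - {0}. p i \<in> elements A"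
    and C: "\<And>v. (\<forall>i\<in>fv \<phi> - {0}. v i \<in> p i) \<Longrightarrow> C = {x \<in> universe upow. sat upow (v(0 := x)) \<phi>}"
    using assms(1) unfolding definable_def by blast
  \<comment> \<open>Parameters are singletons of diagonal elements. Elsewhere \<open>k\<close> is an
    arbitrary element, since \<open>los_theorem\<close> wants every variable assigned within the
    universe.\<close>
  have "\<exists>k\<in>universe K. i \<in> fv \<phi> - {0} \<longrightarrow> p i = {diag k}" for i
  proof (cases "i \<in> fv \<phi> - {0}")
    case True
    then show ?thesis using p assms(2) by (fastforce simp: elements_def)
  next
    case False
    then show ?thesis using struct_K by (auto simp: is_structure_def)
  qed
  then obtain k where k: "\<And>i. k i \<in> universe K" "\<And>i. i \<in> fv \<phi> - {0} \<Longrightarrow> p i = {diag (k i)}"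
    by metis
  define S where "S = {x \<in> universe K. sat K (k(0 := x)) \<phi>}"
  have CS: "cls g \<in> C \<longleftrightarrow> eventually (\<lambda>i. g i \<in> S) F" if g: "g \<in> seqs K" for g
  proof -
    have "cls g \<in> C \<longleftrightarrow> sat upow ((\<lambda>i. diag (k i))(0 := cls g)) \<phi>"
      using C[of "\<lambda>i. diag (k i)"] k(2) g by simp
    also have "(\<lambda>i. diag (k i))(0 := cls g) = (\<lambda>n. cls (((\<lambda>i _. k i)(0 := g)) n))"
      by (auto simp: diag_def)
    also have "sat upow \<dots> \<phi> \<longleftrightarrow> eventually (\<lambda>i. sat K (\<lambda>n. ((\<lambda>i _. k i)(0 := g)) n i) \<phi>) F"
      using g k(1) \<phi> by (intro los_theorem) (auto simp: seqs_def)
    also have "(\<lambda>i. sat K (\<lambda>n. ((\<lambda>i _. k i)(0 := g)) n i) \<phi>) = (\<lambda>i. g i \<in> S)"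
    proof
      fix i
      have "(\<lambda>n. ((\<lambda>i _. k i)(0 := g)) n i) = k(0 := g i)" by auto
      then show "sat K (\<lambda>n. ((\<lambda>i _. k i)(0 := g)) n i) \<phi> \<longleftrightarrow> g i \<in> S"
        using g by (simp add: S_def seqs_def)
    qed
    finally show ?thesis .
  qed
  have inj: "inj_on diag (universe K)"
    using ultra_F by (auto simp: inj_on_def diag_def cls_eq_iff seqs_def ultra_def)
  have sub: "diag ` S \<subseteq> C"
    using CS by (auto simp: diag_def S_def seqs_def)
  have SK: "S \<subseteq> universe K" by (auto simp: S_def)
  have fin: "finite S"
    using finite_subset[OF sub assms(3)] inj_on_subset[OF inj SK] by (rule finite_imageD)
  have "C \<subseteq> diag ` S"
  proof
    fix x assume x: "x \<in> C"
    have "C = {x \<in> universe upow. sat upow ((\<lambda>i. diag (k i))(0 := x)) \<phi>}"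
      by (rule C) (simp add: k(2))
    with x obtain g where g: "g \<in> seqs K" "x = cls g" by auto
    with x have "eventually (\<lambda>i. \<exists>s\<in>S. g i = s) F" using CS by simp
    then obtain s where s: "s \<in> S" "eventually (\<lambda>i. g i = s) F"
      using ultra_bex_finite[OF ultra_F fin, of "\<lambda>s i. g i = s"] by blast
    then have "x = diag s" using g SK by (auto simp: diag_def cls_eq_iff seqs_def)
    with s show "x \<in> diag ` S" by blast
  qed
  with sub fin SK show ?thesis by blast
qed

end

text \<open>
  A class is mapped to the graph of a chosen representative, written as a set of equations
  between constants.
\<close>

lemma ultrapower_class_map:
  obtains cls :: "('a \<Rightarrow> 'a) \<Rightarrow> ('f, 'r, 'a) model_universe"
  where "\<And>g h. cls g = cls h \<longleftrightarrow> eventually (\<lambda>i. g i = h i) F"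
proof -
  define emb :: "('a \<Rightarrow> 'a) \<Rightarrow> ('f, 'r, 'a) model_universe" where
    "emb g = range (\<lambda>i. Eq (Fun (Inr i) []) (Fun (Inr (g i)) []))" for g
  have "g i = h i" if "emb g = emb h" for g h i
  proof -
    have "Eq (Fun (Inr i) []) (Fun (Inr (g i)) []) \<in> emb h"
      unfolding that[symmetric] by (auto simp: emb_def)
    then show ?thesis by (auto simp: emb_def)
  qed
  then have inj: "emb g = emb h \<longleftrightarrow> g = h" for g h by auto
  \<comment> \<open>The choice depends only on the predicate that describes the class of
    \<open>g\<close>, so equivalent sequences receive literally the same representative.\<close>
  define c where "c g = (SOME h. eventually (\<lambda>i. g i = h i) F)" for g :: "'a \<Rightarrow> 'a"
  have c: "eventually (\<lambda>i. g i = c g i) F" for g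
    unfolding c_def by (rule someI[of _ g]) simp
  have "c g = c h \<longleftrightarrow> eventually (\<lambda>i. g i = h i) F" for g h
  proof
    assume "c g = c h"
    then show "eventually (\<lambda>i. g i = h i) F"
      using c[of g] c[of h] by (auto elim: eventually_elim2)
  next
    assume *: "eventually (\<lambda>i. g i = h i) F"
    have "(\<lambda>k. eventually (\<lambda>i. g i = k i) F) = (\<lambda>k. eventually (\<lambda>i. h i = k i) F)"
    proof
      fix k
      from * have "eventually (\<lambda>i. (g i = k i) = (h i = k i)) F" by eventually_elim simp
      then show "eventually (\<lambda>i. g i = k i) F = eventually (\<lambda>i. h i = k i) F"
        by (rule eventually_subst)
    qed
    then show "c g = c h" by (simp add: c_def)
  qed
  then show ?thesis using that[of "emb \<circ> c"] by (simp add: inj)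
qed

section \<open>Valuation rings\<close>

lemma length_poly_deriv: "length (poly_deriv R p) = length p - 1"
  by (induction R p rule: poly_deriv.induct) auto

lemma (in ring) set_poly_deriv:
  assumes "subring V R" and "set p \<subseteq> V"
  shows "set (poly_deriv R p) \<subseteq> V"
proof -
  note V = subringE[OF assms(1)]
  have "[n] \<cdot> a \<in> V" if "a \<in> V" for n :: nat and a
    by (induction n) (use that V in auto)
  with assms(2) V show ?thesis
    by (induction p rule: induct_list012) auto
qed

text \<open>The head of a coefficient list has the length of the tail as its degree. For an empty
  tail the truncated exponent is harmless, because the factor \<open>[0]\<close> makes the term
  vanish.\<close>

lemma (in cring) eval_poly_deriv_Cons:
  assumes "a \<in> carrier R" and "set p \<subseteq> carrier R" and "y \<in> carrier R"
  shows "eval (poly_deriv R (a # p)) y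
    = a \<otimes> ([length p] \<cdot> (y [^] (length p - 1))) \<oplus> eval (poly_deriv R p) y"
proof (cases p)
  case Nil
  then show ?thesis using assms by simp
next
  case (Cons b q)
  then show ?thesis using assms
    by (simp add: length_poly_deriv l_distr r_distr add_pow_ldistr add_pow_rdistr)
qed

text \<open>Induction on \<open>n\<close>, multiplying the expansion by \<open>y \<oplus> h\<close>.
  The remainder \<open>r\<close> is kept inside \<open>V\<close>; this later makes
  \<open>h \<otimes> r\<close> small whenever \<open>h\<close> is.\<close>

lemma (in cring) power_taylor:
  fixes n :: nat
  assumes "subring V R" and "y \<in> V" and "h \<in> V"
  shows "\<exists>r\<in>V. (y \<oplus> h) [^] n = y [^] n \<oplus> h \<otimes> ([n] \<cdot> (y [^] (n - 1)) \<oplus> h \<otimes> r)"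
proof (induction n)
  note V = subringE[OF assms(1)]
  note car = V(1)[THEN subsetD]
  case 0
  show ?case using assms car V by (intro bexI[of _ \<zero>]) auto
next
  note V = subringE[OF assms(1)]
  note car = V(1)[THEN subsetD]
  case (Suc n)
  then obtain r where r: "r \<in> V"
    "(y \<oplus> h) [^] n = y [^] n \<oplus> h \<otimes> ([n] \<cdot> (y [^] (n - 1)) \<oplus> h \<otimes> r)" by blast
  define A d where "A = y [^] n" and "d = [n] \<cdot> (y [^] (n - 1))"
  have AV: "y [^] k \<in> V" for k :: nat
    by (induction k) (use assms V in auto)
  have dV: "d \<in> V"
  proof -
    have "[k] \<cdot> (y [^] (n - 1)) \<in> V" for k :: nat
      by (induction k) (use AV V in auto)
    then show ?thesis by (simp add: d_def)
  qed
  \<comment> \<open>The product rule for \<open>y\<close> times \<open>y [^] n\<close>; at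
    \<open>n = 0\<close> the exponent \<open>n - 1\<close> is truncated, but \<open>d\<close> is
    zero.\<close>
  have dS: "[Suc n] \<cdot> (y [^] (Suc n - 1)) = A \<oplus> y \<otimes> d"
  proof (cases n)
    case 0
    then show ?thesis using car assms by (simp add: A_def d_def)
  next
    case (Suc m)
    have "y \<otimes> d = [n] \<cdot> (y \<otimes> y [^] m)"
      unfolding d_def using car assms(2) Suc add_pow_rdistr[of y "y [^] (n - 1)" n] by simp
    then show ?thesis using car assms(2) Suc by (simp add: A_def m_comm a_comm)
  qed
  have c: "A \<in> carrier R" "d \<in> carrier R" "y \<in> carrier R" "h \<in> carrier R" "r \<in> carrier R"
    using AV dV assms r car by (auto simp: A_def)
  have "(y \<oplus> h) [^] Suc n = (A \<oplus> h \<otimes> (d \<oplus> h \<otimes> r)) \<otimes> (y \<oplus> h)"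
    using r by (simp add: A_def d_def)
  also have "\<dots> = A \<otimes> y \<oplus> h \<otimes> ((A \<oplus> y \<otimes> d) \<oplus> h \<otimes> (d \<oplus> (r \<otimes> y \<oplus> h \<otimes> r)))"
    using c by algebra
  also have "A \<otimes> y = y [^] Suc n" by (simp add: A_def)
  finally show ?case
    using assms r dV V unfolding dS
    by (intro bexI[of _ "d \<oplus> (r \<otimes> y \<oplus> h \<otimes> r)"]) auto
qed

lemma (in ring) eval_closed_subring:
  assumes "subring V R" and "set p \<subseteq> V" and "x \<in> V"
  shows "eval p x \<in> V"
proof -
  note V = subringE[OF assms(1)]
  have "x [^] k \<in> V" for k :: nat
    by (induction k) (use assms V in auto)
  with assms(2) V show ?thesis by (induction p) auto
qed

text \<open>Both sides are linear in the coefficients, so \<open>power_taylor\<close> for the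
  leading monomial is added to the expansion of the tail.\<close>

lemma (in cring) eval_taylor:
  assumes "subring V R" and "set p \<subseteq> V" and "y \<in> V" and "h \<in> V"
  shows "\<exists>r\<in>V. eval p (y \<oplus> h) = eval p y \<oplus> h \<otimes> (eval (poly_deriv R p) y \<oplus> h \<otimes> r)"
  using assms(2)
proof (induction p)
  note V = subringE[OF assms(1)]
  note car = V(1)[THEN subsetD]
  case Nil
  show ?case using assms car V by (intro bexI[of _ \<zero>]) auto
next
  note V = subringE[OF assms(1)]
  note car = V(1)[THEN subsetD]
  case (Cons a p)
  then obtain s where s: "s \<in> V"
    "eval p (y \<oplus> h) = eval p y \<oplus> h \<otimes> (eval (poly_deriv R p) y \<oplus> h \<otimes> s)" by auto
  obtain r where r: "r \<in> V" "(y \<oplus> h) [^] length p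
      = y [^] length p \<oplus> h \<otimes> ([length p] \<cdot> (y [^] (length p - 1)) \<oplus> h \<otimes> r)"
    using power_taylor[OF assms(1,3,4)] by blast
  define A d e e' where "A = y [^] length p" and "d = [length p] \<cdot> (y [^] (length p - 1))"
    and "e = eval p y" and "e' = eval (poly_deriv R p) y"
  have c: "A \<in> carrier R" "d \<in> carrier R" "e \<in> carrier R" "e' \<in> carrier R" "y \<in> carrier R"
    "h \<in> carrier R" "r \<in> carrier R" "s \<in> carrier R" "a \<in> carrier R"
    using assms r s car Cons.prems eval_closed_subring[OF assms(1) _ assms(3)]
      set_poly_deriv[OF assms(1)] by (auto simp: A_def d_def e_def e'_def)
  have "eval (a # p) (y \<oplus> h) = a \<otimes> (A \<oplus> h \<otimes> (d \<oplus> h \<otimes> r)) \<oplus> (e \<oplus> h \<otimes> (e' \<oplus> h \<otimes> s))"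
    using s r by (simp add: A_def d_def e_def e'_def)
  also have "\<dots> = (a \<otimes> A \<oplus> e) \<oplus> h \<otimes> ((a \<otimes> d \<oplus> e') \<oplus> h \<otimes> (a \<otimes> r \<oplus> s))"
    using c by algebra
  also have "a \<otimes> A \<oplus> e = eval (a # p) y" by (simp add: A_def e_def)
  also have "a \<otimes> d \<oplus> e' = eval (poly_deriv R (a # p)) y"
    using Cons.prems car assms by (subst eval_poly_deriv_Cons) (auto simp: d_def e'_def)
  finally show ?case
    using r s Cons.prems V by (intro bexI[of _ "a \<otimes> r \<oplus> s"]) auto
qed

section \<open>Valuation rings, their maximal ideals and their units\<close>

locale valuation = field R for R (structure) +
  fixes V :: "'a set"
  assumes subring_V: "subring V R"
    and total: "\<And>x. x \<in> carrier R - {\<zero>} \<Longrightarrow> x \<in> V \<or> inv x \<in> V"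
begin

lemmas V_closed [simp] = subringE(2,3,5,6,7)[OF subring_V]

lemma V_carrier [simp]: "x \<in> V \<Longrightarrow> x \<in> carrier R"
  using subringE(1)[OF subring_V] by blast

text \<open>The maximal ideal |x| < 1. Values are not constructed: that |x| is at most, less than,
  or equal to |y| for nonzero \<open>y\<close> is expressed by writing \<open>x\<close> as
  \<open>y\<close> times an element of \<open>V\<close>, \<open>nonunits\<close> or
  \<open>vunits\<close>.\<close>

definition nonunits :: "'a set" where
  "nonunits = {x \<in> V. \<forall>c\<in>V. x \<otimes> c \<noteq> \<one>}"

lemma nonunits_V [simp]: "x \<in> nonunits \<Longrightarrow> x \<in> V"
  by (simp add: nonunits_def)

lemma nonunits_mult: "x \<in> nonunits \<Longrightarrow> c \<in> V \<Longrightarrow> x \<otimes> c \<in> nonunits"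
  unfolding nonunits_def using m_assoc[of x c] by simp

lemma nonunits_mult_left: "x \<in> nonunits \<Longrightarrow> c \<in> V \<Longrightarrow> c \<otimes> x \<in> nonunits"
  using nonunits_mult[of x c] by (simp add: m_comm)

lemma zero_nonunits [simp]: "\<zero> \<in> nonunits"
  by (simp add: nonunits_def del: nonunits_V)

lemma one_not_nonunits [simp]: "\<one> \<notin> nonunits"
  by (auto simp: nonunits_def simp del: nonunits_V)

lemma nonunits_minus [simp]: "x \<in> nonunits \<Longrightarrow> \<ominus> x \<in> nonunits"
  using nonunits_mult[of x "\<ominus> \<one>"] by (simp add: r_minus)

lemma inv_closed [simp]: "x \<in> carrier R \<Longrightarrow> x \<noteq> \<zero> \<Longrightarrow> inv x \<in> carrier R"
  using field_Units by (metis DiffI Units_inv_closed singletonD)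

lemma r_inv_field [simp]: "x \<in> carrier R \<Longrightarrow> x \<noteq> \<zero> \<Longrightarrow> x \<otimes> inv x = \<one>"
  using field_Units by (metis DiffI Units_r_inv singletonD)

lemma nonunits_add_aux:
  assumes "x \<in> nonunits" "y \<in> nonunits" "y \<noteq> \<zero>" "x \<otimes> inv y \<in> V"
  shows "x \<oplus> y \<in> nonunits"
proof -
  have c: "x \<in> carrier R" "y \<in> carrier R" "inv y \<in> carrier R" using assms by auto
  have "y \<otimes> (x \<otimes> inv y \<oplus> \<one>) = x \<otimes> (y \<otimes> inv y) \<oplus> y" using c by algebra
  also have "\<dots> = x \<oplus> y" using c assms by simp
  finally show ?thesis using nonunits_mult[of y "x \<otimes> inv y \<oplus> \<one>"] assms by simp
qed

text \<open>By \<open>total\<close> one of \<open>x \<otimes> inv y\<close> and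
  \<open>y \<otimes> inv x\<close> lies in \<open>V\<close>, so the sum is a multiple, within
  \<open>V\<close>, of one of the two summands.\<close>

lemma nonunits_add [simp]:
  assumes "x \<in> nonunits" "y \<in> nonunits"
  shows "x \<oplus> y \<in> nonunits"
proof (cases "x = \<zero> \<or> y = \<zero>")
  case True
  then show ?thesis using assms by auto
next
  case False
  have c: "x \<in> carrier R" "y \<in> carrier R" "inv y \<in> carrier R" "inv x \<in> carrier R"
    using assms False by auto
  have "(x \<otimes> inv y) \<otimes> (y \<otimes> inv x) = (x \<otimes> inv x) \<otimes> (y \<otimes> inv y)" using c by algebra
  then have one: "(x \<otimes> inv y) \<otimes> (y \<otimes> inv x) = \<one>" using c False by simp
  then have nz: "x \<otimes> inv y \<noteq> \<zero>" using c by auto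
  have "inv (x \<otimes> inv y) = y \<otimes> inv x"
    using one c by (intro comm_inv_char) auto
  with total[of "x \<otimes> inv y"] nz c have "x \<otimes> inv y \<in> V \<or> y \<otimes> inv x \<in> V" by auto
  then show ?thesis
    using nonunits_add_aux[of x y] nonunits_add_aux[of y x] assms False c by (auto simp: a_comm)
qed

lemma nonunits_diff [simp]: "x \<in> nonunits \<Longrightarrow> y \<in> nonunits \<Longrightarrow> x \<ominus> y \<in> nonunits"
  by (simp add: a_minus_def)

definition vunits :: "'a set" where
  "vunits = V - nonunits"

lemma vunits_iff: "u \<in> vunits \<longleftrightarrow> u \<in> V \<and> (\<exists>c\<in>V. u \<otimes> c = \<one>)"
  by (auto simp: vunits_def nonunits_def simp del: nonunits_V)

lemma vunits_V [simp]: "u \<in> vunits \<Longrightarrow> u \<in> V"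
  by (simp add: vunits_def)

lemma vunits_nonzero: "u \<in> vunits \<Longrightarrow> u \<noteq> \<zero>"
  by (auto simp: vunits_def simp del: vunits_V)

lemma vunits_inv:
  assumes "u \<in> vunits" shows "inv u \<in> vunits"
proof -
  obtain c where c: "c \<in> V" "u \<otimes> c = \<one>" using assms by (auto simp: vunits_iff simp del: vunits_V)
  then have "inv u = c" using assms by (intro comm_inv_char) auto
  then show ?thesis using c assms by (auto simp: vunits_iff m_comm simp del: vunits_V)
qed

lemma vunits_mult: "u \<in> vunits \<Longrightarrow> v \<in> vunits \<Longrightarrow> u \<otimes> v \<in> vunits"
proof -
  assume a: "u \<in> vunits" "v \<in> vunits"
  then obtain c d where c: "c \<in> V" "u \<otimes> c = \<one>" "d \<in> V" "v \<otimes> d = \<one>" by (auto simp: vunits_iff simp del: vunits_V)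
  have cc: "u \<in> carrier R" "v \<in> carrier R" "c \<in> carrier R" "d \<in> carrier R" using a c by auto
  have "(u \<otimes> v) \<otimes> (c \<otimes> d) = (u \<otimes> c) \<otimes> (v \<otimes> d)" using cc by algebra
  then have "(u \<otimes> v) \<otimes> (c \<otimes> d) = \<one>" using c by simp
  then show ?thesis using a c by (auto simp: vunits_iff simp del: vunits_V)
qed

lemma vunits_add_nonunits:
  assumes "u \<in> vunits" "x \<in> nonunits" shows "u \<oplus> x \<in> vunits"
proof -
  have "u \<oplus> x \<in> nonunits \<Longrightarrow> u \<in> nonunits"
  proof -
    assume "u \<oplus> x \<in> nonunits"
    then have "(u \<oplus> x) \<ominus> x \<in> nonunits" using assms by simp
    moreover have "(u \<oplus> x) \<ominus> x = u" using assms V_carrier[OF vunits_V] V_carrier[OF nonunits_V] by algebra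
    ultimately show "u \<in> nonunits" by simp
  qed
  then show ?thesis using assms by (auto simp: vunits_def simp del: vunits_V)
qed

lemma one_vunits [simp]: "\<one> \<in> vunits" by (simp add: vunits_def del: vunits_V)

text \<open>Here \<open>x\<close> may lie outside \<open>V\<close>. Within \<open>V\<close> it is a
  unit; outside, \<open>total\<close> provides the inverse.\<close>

lemma inv_V:
  assumes "x \<in> carrier R" "x \<notin> nonunits"
  shows "x \<noteq> \<zero>" and "inv x \<in> V"
proof -
  show nz: "x \<noteq> \<zero>" using assms by auto
  show "inv x \<in> V"
  proof (cases "x \<in> V")
    case True
    then show ?thesis using assms vunits_inv[of x] by (auto simp: vunits_def simp del: vunits_V)
  next
    case False
    then show ?thesis using total[of x] assms nz by auto
  qed
qed

end

section \<open>Newton approximation\<close>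

locale hensel_datum = valuation +
  fixes p :: "'a list" and a :: 'a
  assumes set_p: "set p \<subseteq> V" and a_V: "a \<in> V"
    and eval_a: "eval p a \<in> nonunits" and deriv_a: "eval (poly_deriv R p) a \<in> vunits"
begin

section \<open>The open unit ball around \<open>a\<close>, on which \<open>p\<close> preserves
  distances\<close>

definition ball :: "'a set" where
  "ball = {x \<in> V. x \<ominus> a \<in> nonunits}"

lemma ball_V [simp]: "x \<in> ball \<Longrightarrow> x \<in> V"
  unfolding ball_def by blast

lemma ball_minus [simp]: "x \<in> ball \<Longrightarrow> x \<ominus> a \<in> nonunits"
  unfolding ball_def by blast

lemma ballI: "x \<in> V \<Longrightarrow> x \<ominus> a \<in> nonunits \<Longrightarrow> x \<in> ball"
  unfolding ball_def by blast

lemma ball_diff: "x \<in> ball \<Longrightarrow> y \<in> ball \<Longrightarrow> x \<ominus> y \<in> nonunits"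
proof -
  assume xy: "x \<in> ball" "y \<in> ball"
  then have c: "x \<in> carrier R" "y \<in> carrier R" "a \<in> carrier R" using a_V by auto
  have "x \<ominus> y = (x \<ominus> a) \<ominus> (y \<ominus> a)" using c by algebra
  then show ?thesis using xy by simp
qed

lemma ball_add: "x \<in> ball \<Longrightarrow> t \<in> nonunits \<Longrightarrow> x \<oplus> t \<in> ball"
proof -
  assume xt: "x \<in> ball" "t \<in> nonunits"
  then have c: "x \<in> carrier R" "t \<in> carrier R" "a \<in> carrier R" using a_V by auto
  have "(x \<oplus> t) \<ominus> a = (x \<ominus> a) \<oplus> t" using c by algebra
  then show ?thesis using xt by (intro ballI) simp_all
qed

lemma a_ball: "a \<in> ball"
  using a_V by (intro ballI) (simp_all add: r_neg a_minus_def)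

lemma eval_p_V [simp]: "x \<in> V \<Longrightarrow> eval p x \<in> V"
  using eval_closed_subring[OF subring_V set_p] .

lemma add_minus_cancel: "x \<in> V \<Longrightarrow> y \<in> V \<Longrightarrow> y \<oplus> (x \<ominus> y) = x"
proof -
  assume "x \<in> V" "y \<in> V"
  then have c: "x \<in> carrier R" "y \<in> carrier R" by auto
  then show ?thesis by algebra
qed

text \<open>Taylor expansion of the derivative at \<open>a\<close>: its value at \<open>x\<close>
  differs from a unit by a multiple of the nonunit \<open>x \<ominus> a\<close>.\<close>

lemma deriv_vunits:
  assumes "x \<in> ball" shows "eval (poly_deriv R p) x \<in> vunits"
proof -
  have x: "x \<in> V" "x \<ominus> a \<in> nonunits" using assms by auto
  obtain r where r: "r \<in> V" "eval (poly_deriv R p) (a \<oplus> (x \<ominus> a)) = eval (poly_deriv R p) a \<oplus>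
      (x \<ominus> a) \<otimes> (eval (poly_deriv R (poly_deriv R p)) a \<oplus> (x \<ominus> a) \<otimes> r)"
    using eval_taylor[OF subring_V set_poly_deriv[OF subring_V set_p] a_V] x by (meson nonunits_V)
  have "eval (poly_deriv R (poly_deriv R p)) a \<in> V"
    by (intro eval_closed_subring set_poly_deriv set_p a_V subring_V)
  then have "(x \<ominus> a) \<otimes> (eval (poly_deriv R (poly_deriv R p)) a \<oplus> (x \<ominus> a) \<otimes> r) \<in> nonunits"
    using x r by (intro nonunits_mult) auto
  then show ?thesis
    using vunits_add_nonunits[OF deriv_a] r x by (simp add: add_minus_cancel a_V)
qed

text \<open>\<open>p\<close> is an isometry on the ball: in the Taylor expansion at
  \<open>y\<close>, the cofactor of \<open>x \<ominus> y\<close> is the derivative, a unit, plus a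
  nonunit.\<close>

lemma eval_diff:
  assumes "x \<in> ball" "y \<in> ball"
  shows "\<exists>u\<in>vunits. eval p x = eval p y \<oplus> (x \<ominus> y) \<otimes> u"
proof -
  have h: "x \<ominus> y \<in> nonunits" using assms by (rule ball_diff)
  obtain r where r: "r \<in> V" "eval p (y \<oplus> (x \<ominus> y)) = eval p y \<oplus>
      (x \<ominus> y) \<otimes> (eval (poly_deriv R p) y \<oplus> (x \<ominus> y) \<otimes> r)"
    using eval_taylor[OF subring_V set_p] h assms by (meson nonunits_V ball_V)
  have "eval (poly_deriv R p) y \<oplus> (x \<ominus> y) \<otimes> r \<in> vunits"
    using h r by (intro vunits_add_nonunits deriv_vunits assms nonunits_mult)
  then show ?thesis
    using r(2) assms by (auto simp: add_minus_cancel)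
qed

lemma eval_nonunits:
  assumes "x \<in> ball" shows "eval p x \<in> nonunits"
proof -
  obtain u where "u \<in> vunits" "eval p x = eval p a \<oplus> (x \<ominus> a) \<otimes> u"
    using eval_diff[OF assms a_ball] by blast
  then show ?thesis
    using eval_a assms nonunits_mult[of "x \<ominus> a" u] by simp
qed

text \<open>\<open>|p(x)| < |p(y)|\<close>, provided that \<open>p(y) \<noteq> 0\<close>\<close>

definition closer :: "'a \<Rightarrow> 'a set" where
  "closer y = {x \<in> ball. \<exists>t\<in>nonunits. eval p x = eval p y \<otimes> t}"

text \<open>The Newton step h = -p(y)/p'(y) cancels the linear part of the expansion. The quadratic
  rest is p(y) times a nonunit, because \<open>h\<close> itself is a nonunit.\<close>

lemma newton:
  assumes "y \<in> ball"
  shows "closer y \<noteq> {}"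
proof -
  define d where "d = eval (poly_deriv R p) y"
  have d: "d \<in> vunits" unfolding d_def by (rule deriv_vunits[OF assms])
  then have di: "inv d \<in> V" "d \<otimes> inv d = \<one>"
    using vunits_inv[OF d] vunits_nonzero[OF d] by auto
  define e where "e = eval p y"
  have e: "e \<in> nonunits" unfolding e_def by (rule eval_nonunits[OF assms])
  define h where "h = \<ominus> (e \<otimes> inv d)"
  have h: "h \<in> nonunits" unfolding h_def using e di by (intro nonunits_minus nonunits_mult)
  obtain r where r: "r \<in> V" "eval p (y \<oplus> h) = e \<oplus> h \<otimes> (d \<oplus> h \<otimes> r)"
    using eval_taylor[OF subring_V set_p, of y h] h assms unfolding e_def d_def by auto
  have c: "e \<in> carrier R" "inv d \<in> carrier R" "d \<in> carrier R" "r \<in> carrier R" "h \<in> carrier R"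
    using e d r h di by auto
  have "e \<oplus> h \<otimes> (d \<oplus> h \<otimes> r) = e \<ominus> e \<otimes> (d \<otimes> inv d) \<ominus> e \<otimes> (inv d \<otimes> (h \<otimes> r))"
    unfolding h_def using c(1-4) by algebra
  also have "\<dots> = e \<otimes> \<ominus> (inv d \<otimes> (h \<otimes> r))"
    unfolding di using c by algebra
  finally have "eval p (y \<oplus> h) = e \<otimes> \<ominus> (inv d \<otimes> (h \<otimes> r))" using r by simp
  moreover have "\<ominus> (inv d \<otimes> (h \<otimes> r)) \<in> nonunits"
    using di h r by (intro nonunits_minus nonunits_mult_left nonunits_mult)
  ultimately have "y \<oplus> h \<in> closer y"
    using ball_add[OF assms h] unfolding closer_def e_def by blast
  then show ?thesis by blast
qed

lemma closer_ball: "closer y \<subseteq> ball"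
  by (auto simp: closer_def)

lemma closer_trans:
  assumes "y \<in> closer c" "x \<in> closer y" "c \<in> ball"
  shows "x \<in> closer c"
proof -
  obtain t s where ts: "t \<in> nonunits" "s \<in> nonunits" "eval p y = eval p c \<otimes> t" "eval p x = eval p y \<otimes> s"
    using assms by (auto simp: closer_def)
  then have "eval p x = eval p c \<otimes> (t \<otimes> s)" "t \<otimes> s \<in> nonunits"
    using assms by (auto simp: m_assoc intro: nonunits_mult)
  then show ?thesis using assms closer_ball by (auto simp: closer_def)
qed

text \<open>By totality one of p(y), p(z) is a multiple of the other within \<open>V\<close>, and it
  gives the smaller set. Hence these sets form a filter base.\<close>

lemma closer_chain:
  assumes "y \<in> ball" "z \<in> ball" "eval p y \<noteq> \<zero>" "eval p z \<noteq> \<zero>"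
  shows "closer y \<subseteq> closer z \<or> closer z \<subseteq> closer y"
proof -
  have *: "closer y \<subseteq> closer z"
    if "y \<in> ball" "z \<in> ball" "eval p z \<noteq> \<zero>" "eval p y \<otimes> inv eval p z \<in> V" for y z
  proof
    fix x assume "x \<in> closer y"
    then obtain t where t: "t \<in> nonunits" "eval p x = eval p y \<otimes> t" "x \<in> ball" by (auto simp: closer_def)
    define e f where "e = eval p y" and "f = eval p z"
    have c: "e \<in> carrier R" "f \<in> carrier R" "inv f \<in> carrier R" "t \<in> carrier R"
      using that t by (auto simp: e_def f_def)
    have "f \<otimes> ((e \<otimes> inv f) \<otimes> t) = (f \<otimes> inv f) \<otimes> (e \<otimes> t)" using c by algebra
    also have "f \<otimes> inv f = \<one>" using that c by (simp add: f_def)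
    finally have "eval p x = eval p z \<otimes> ((e \<otimes> inv f) \<otimes> t)"
      using t c by (simp add: e_def f_def)
    moreover have "(e \<otimes> inv f) \<otimes> t \<in> nonunits"
      using that t by (intro nonunits_mult_left) (auto simp: e_def f_def)
    ultimately show "x \<in> closer z" using t by (auto simp: closer_def)
  qed
  define e f where "e = eval p y" and "f = eval p z"
  have c: "e \<in> carrier R" "f \<in> carrier R" "inv f \<in> carrier R" "inv e \<in> carrier R"
    "e \<noteq> \<zero>" "f \<noteq> \<zero>"
    using assms by (auto simp: e_def f_def)
  have "(e \<otimes> inv f) \<otimes> (f \<otimes> inv e) = (e \<otimes> inv e) \<otimes> (f \<otimes> inv f)" using c(1-4) by algebra
  then have one: "(e \<otimes> inv f) \<otimes> (f \<otimes> inv e) = \<one>" using c by simp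
  have "e \<otimes> inv f \<noteq> \<zero>"
  proof
    assume "e \<otimes> inv f = \<zero>"
    with one c show False by simp
  qed
  moreover have "inv (e \<otimes> inv f) = f \<otimes> inv e"
    using one c(1-4) by (intro comm_inv_char) auto
  ultimately have "e \<otimes> inv f \<in> V \<or> f \<otimes> inv e \<in> V"
    using total[of "e \<otimes> inv f"] c(1-4) by auto
  then show ?thesis
    using *[of y z] *[of z y] assms by (auto simp: e_def f_def)
qed

text \<open>As p(x) is p(y) times a nonunit, p(x) - p(y) is p(y) times a unit, and by
  \<open>eval_diff\<close> so is \<open>x \<ominus> y\<close>.\<close>

lemma closer_diff:
  assumes "x \<in> closer y" "y \<in> ball"
  shows "\<exists>v\<in>vunits. x \<ominus> y = eval p y \<otimes> v"
proof -
  obtain t where t: "t \<in> nonunits" "eval p x = eval p y \<otimes> t" "x \<in> ball"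
    using assms by (auto simp: closer_def)
  obtain u where u: "u \<in> vunits" "eval p x = eval p y \<oplus> (x \<ominus> y) \<otimes> u"
    using eval_diff[OF t(3) assms(2)] by blast
  define e where "e = eval p y"
  have c: "e \<in> carrier R" "u \<in> carrier R" "inv u \<in> carrier R" "t \<in> carrier R"
    "x \<in> carrier R" "y \<in> carrier R"
    using assms t u vunits_inv[OF u(1)] by (auto simp: e_def)
  have "e \<oplus> (x \<ominus> y) \<otimes> u = e \<otimes> t" using t u by (simp add: e_def)
  moreover have "(x \<ominus> y) \<otimes> u = (e \<oplus> (x \<ominus> y) \<otimes> u) \<ominus> e" using c by algebra
  ultimately have *: "(x \<ominus> y) \<otimes> u = e \<otimes> t \<ominus> e" by simp
  have "x \<ominus> y = (x \<ominus> y) \<otimes> (u \<otimes> inv u)" using c vunits_nonzero[OF u(1)] by simp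
  also have "\<dots> = ((x \<ominus> y) \<otimes> u) \<otimes> inv u" using c by algebra
  also have "\<dots> = e \<otimes> ((\<ominus> \<one> \<oplus> t) \<otimes> inv u)" unfolding * using c by algebra
  finally have "x \<ominus> y = e \<otimes> ((\<ominus> \<one> \<oplus> t) \<otimes> inv u)" .
  moreover have "\<ominus> \<one> \<in> vunits"
    unfolding vunits_iff by (auto intro!: bexI[of _ "\<ominus> \<one>"] simp: l_minus r_minus simp del: vunits_V)
  ultimately show ?thesis
    using t(1) u(1) unfolding e_def by (blast intro: vunits_mult vunits_inv vunits_add_nonunits)
qed

text \<open>This will give rv(x - c) = rv(y - c). For \<open>c\<close> outside the ball, |x - c| is
  at least 1 and |y - x| is less. For \<open>c\<close> in the ball, y - x and x - c are p(y) and
  p(c) up to units, and p(y) is p(c) times a nonunit.\<close>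

lemma closer_diff_less:
  assumes "x \<in> closer y" "y \<in> ball" "c \<in> carrier R" "c \<in> ball \<Longrightarrow> y \<in> closer c"
  shows "\<exists>t\<in>nonunits. y \<ominus> x = (x \<ominus> c) \<otimes> t"
proof -
  have x: "x \<in> ball" using assms closer_ball by blast
  show ?thesis
  proof (cases "c \<in> ball")
    case False
    have xc: "x \<in> carrier R" "y \<in> carrier R" using x assms by auto
    have "x \<ominus> c \<notin> nonunits"
    proof
      assume "x \<ominus> c \<in> nonunits"
      then have "x \<oplus> \<ominus> (x \<ominus> c) \<in> ball" using ball_add[OF x] by simp
      moreover have "x \<oplus> \<ominus> (x \<ominus> c) = c" using xc assms(3) by algebra
      ultimately show False using False by simp
    qed
    then have i: "x \<ominus> c \<noteq> \<zero>" "inv (x \<ominus> c) \<in> V"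
      using inv_V[of "x \<ominus> c"] xc assms by auto
    define w i where "w = x \<ominus> c" and "i = inv (x \<ominus> c)"
    have wi: "w \<otimes> i = \<one>" "w \<in> carrier R" "i \<in> carrier R"
      using i xc assms unfolding w_def i_def by auto
    have yx: "y \<ominus> x \<in> nonunits" "y \<ominus> x \<in> carrier R" using ball_diff[OF assms(2) x] by auto
    have "w \<otimes> (i \<otimes> (y \<ominus> x)) = (w \<otimes> i) \<otimes> (y \<ominus> x)" using m_assoc[OF wi(2,3) yx(2)] by simp
    then have "y \<ominus> x = w \<otimes> (i \<otimes> (y \<ominus> x))" using wi yx by (simp only: wi(1) l_one)
    moreover have "i \<otimes> (y \<ominus> x) \<in> nonunits"
      using yx i unfolding i_def by (intro nonunits_mult_left)
    ultimately show ?thesis unfolding w_def by blast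
  next
    case True
    then have yc: "y \<in> closer c" by (rule assms)
    then obtain t where t: "t \<in> nonunits" "eval p y = eval p c \<otimes> t" by (auto simp: closer_def)
    obtain v where v: "v \<in> vunits" "x \<ominus> y = eval p y \<otimes> v"
      using closer_diff[OF assms(1,2)] by blast
    obtain w where w: "w \<in> vunits" "x \<ominus> c = eval p c \<otimes> w"
      using closer_diff[OF closer_trans[OF yc assms(1) True] True] by blast
    define e where "e = eval p c"
    have c: "e \<in> carrier R" "t \<in> carrier R" "v \<in> carrier R" "w \<in> carrier R" "inv w \<in> carrier R"
      "x \<in> carrier R" "y \<in> carrier R"
      using True t v w vunits_inv[OF w(1)] x assms by (auto simp: e_def)
    have "y \<ominus> x = \<ominus> (x \<ominus> y)" using c by algebra
    also have "\<dots> = (e \<otimes> (w \<otimes> inv w)) \<otimes> \<ominus> (t \<otimes> v)"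
      using c t v vunits_nonzero[OF w(1)] by (simp add: e_def m_assoc r_minus)
    also have "\<dots> = (e \<otimes> w) \<otimes> (inv w \<otimes> \<ominus> (t \<otimes> v))"
      using c by algebra
    finally have "y \<ominus> x = (x \<ominus> c) \<otimes> (inv w \<otimes> \<ominus> (t \<otimes> v))" using w by (simp add: e_def)
    moreover have "inv w \<otimes> \<ominus> (t \<otimes> v) \<in> nonunits"
      using t v vunits_inv[OF w(1)] by (intro nonunits_mult_left nonunits_minus nonunits_mult) auto
    ultimately show ?thesis by blast
  qed
qed

end

section \<open>Valued fields and their ultrapowers\<close>

context valuation
begin

definition lead_class :: "'a \<Rightarrow> 'a set" where
  "lead_class x = x <# (\<one> <+ nonunits)"

lemma lead_class_iff: "y \<in> lead_class x \<longleftrightarrow> (\<exists>t\<in>nonunits. y = x \<otimes> (\<one> \<oplus> t))"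
  by (auto simp: lead_class_def l_coset_def a_l_coset_def)

lemma one_add_nonunits_mult:
  assumes "s \<in> nonunits" "t \<in> nonunits" "x \<in> carrier R"
  shows "\<exists>r\<in>nonunits. x \<otimes> (\<one> \<oplus> s) \<otimes> (\<one> \<oplus> t) = x \<otimes> (\<one> \<oplus> r)"
proof
  have c: "s \<in> carrier R" "t \<in> carrier R" using assms by auto
  then show "x \<otimes> (\<one> \<oplus> s) \<otimes> (\<one> \<oplus> t) = x \<otimes> (\<one> \<oplus> (s \<oplus> (t \<oplus> s \<otimes> t)))"
    using assms(3) by algebra
  show "s \<oplus> (t \<oplus> s \<otimes> t) \<in> nonunits" using assms by (intro nonunits_add nonunits_mult) auto
qed

text \<open>With i the inverse of the unit 1 + t, one has i = 1 - t i.\<close>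

lemma one_add_nonunits_inv:
  assumes "t \<in> nonunits"
  shows "\<exists>s\<in>nonunits. (\<one> \<oplus> t) \<otimes> (\<one> \<oplus> s) = \<one>"
proof
  define i where "i = inv (\<one> \<oplus> t)"
  have u: "\<one> \<oplus> t \<in> vunits" using assms by (intro vunits_add_nonunits) auto
  have i: "i \<in> V" "(\<one> \<oplus> t) \<otimes> i = \<one>"
    using vunits_inv[OF u] vunits_nonzero[OF u] assms by (auto simp: i_def)
  have c: "t \<in> carrier R" "i \<in> carrier R" using assms i by auto
  have "(\<one> \<oplus> t) \<otimes> (\<one> \<oplus> \<ominus> (t \<otimes> i)) = \<one> \<oplus> t \<ominus> t \<otimes> ((\<one> \<oplus> t) \<otimes> i)"
    using c by algebra
  also have "\<dots> = \<one>" unfolding i using c by algebra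
  finally show "(\<one> \<oplus> t) \<otimes> (\<one> \<oplus> \<ominus> (t \<otimes> i)) = \<one>" .
  show "\<ominus> (t \<otimes> i) \<in> nonunits" using assms i by (intro nonunits_minus nonunits_mult)
qed

text \<open>The one-units are closed under products and inverses, so the two cosets contain each
  other.\<close>

lemma lead_class_mult_one_add:
  assumes "x \<in> carrier R" "t \<in> nonunits"
  shows "lead_class (x \<otimes> (\<one> \<oplus> t)) = lead_class x"
proof -
  have sub: "lead_class (x \<otimes> (\<one> \<oplus> t)) \<subseteq> lead_class x" if "x \<in> carrier R" "t \<in> nonunits" for x t
    using one_add_nonunits_mult[OF that(2) _ that(1)] by (auto simp: lead_class_iff)
  obtain s where s: "s \<in> nonunits" "(\<one> \<oplus> t) \<otimes> (\<one> \<oplus> s) = \<one>"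
    using one_add_nonunits_inv[OF assms(2)] by blast
  have c: "t \<in> carrier R" "s \<in> carrier R" using assms s by auto
  have "x \<otimes> (\<one> \<oplus> t) \<otimes> (\<one> \<oplus> s) = x \<otimes> ((\<one> \<oplus> t) \<otimes> (\<one> \<oplus> s))"
    using c assms by (intro m_assoc) auto
  then have "x \<otimes> (\<one> \<oplus> t) \<otimes> (\<one> \<oplus> s) = x" using s assms by simp
  then have "lead_class x \<subseteq> lead_class (x \<otimes> (\<one> \<oplus> t))"
    using sub[OF _ s(1), of "x \<otimes> (\<one> \<oplus> t)"] assms c by auto
  then show ?thesis using sub[OF assms] by blast
qed

end

section \<open>Passage from structures to fields with a valuation ring\<close>

lemma carrier_ring_of: "carrier (ring_of L M) = universe M"
  by (simp add: ring_of_def)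

lemma ring_of_ops:
  "x \<otimes>\<^bsub>ring_of L M\<^esub> y = fun_int M (mul_sym L) [x, y]"
  "x \<oplus>\<^bsub>ring_of L M\<^esub> y = fun_int M (add_sym L) [x, y]"
  by (simp_all add: ring_of_def)

lemma valuation_ring_of:
  assumes "valued_field L M"
  shows "valuation (ring_of L M) (val_ring L M)"
  using assms unfolding valued_field_def valuation_def valuation_axioms_def carrier_ring_of by blast

lemma val_less_one_iff:
  assumes "valued_field L M" and "x \<in> universe M"
  shows "val_less L M x \<one>\<^bsub>ring_of L M\<^esub> \<longleftrightarrow> x \<in> valuation.nonunits (ring_of L M) (val_ring L M)"
proof -
  interpret valuation "ring_of L M" "val_ring L M" by (rule valuation_ring_of[OF assms(1)])
  have xc: "x \<in> carrier (ring_of L M)" using assms(2) by (simp add: carrier_ring_of)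
  have "val_le L M x \<one>\<^bsub>ring_of L M\<^esub> \<longleftrightarrow> x \<in> val_ring L M"
    unfolding val_le_def using xc l_one V_carrier by metis
  moreover have "val_le L M \<one>\<^bsub>ring_of L M\<^esub> x \<longleftrightarrow> (\<exists>c\<in>val_ring L M. x \<otimes>\<^bsub>ring_of L M\<^esub> c = \<one>\<^bsub>ring_of L M\<^esub>)"
    unfolding val_le_def by metis
  ultimately show ?thesis unfolding val_less_def nonunits_def by blast
qed

lemma max_ideal_eq:
  assumes "valued_field L M"
  shows "max_ideal L M = valuation.nonunits (ring_of L M) (val_ring L M)"
proof -
  interpret valuation "ring_of L M" "val_ring L M" by (rule valuation_ring_of[OF assms])
  show ?thesis
    using val_less_one_iff[OF assms] V_carrier[OF nonunits_V] unfolding max_ideal_def carrier_ring_of by auto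
qed

lemma val_eq_one_iff:
  assumes "valued_field L M" and "x \<in> universe M"
  shows "val_eq L M x \<one>\<^bsub>ring_of L M\<^esub> \<longleftrightarrow> x \<in> valuation.vunits (ring_of L M) (val_ring L M)"
proof -
  interpret valuation "ring_of L M" "val_ring L M" by (rule valuation_ring_of[OF assms(1)])
  have xc: "x \<in> carrier (ring_of L M)" using assms(2) by (simp add: carrier_ring_of)
  have "val_le L M x \<one>\<^bsub>ring_of L M\<^esub> \<longleftrightarrow> x \<in> val_ring L M"
    unfolding val_le_def using xc l_one V_carrier by metis
  moreover have "val_le L M \<one>\<^bsub>ring_of L M\<^esub> x \<longleftrightarrow> (\<exists>c\<in>val_ring L M. x \<otimes>\<^bsub>ring_of L M\<^esub> c = \<one>\<^bsub>ring_of L M\<^esub>)"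
    unfolding val_le_def by metis
  ultimately show ?thesis unfolding val_eq_def vunits_iff by blast
qed

lemma rv_eq:
  assumes "valued_field L M"
  shows "rv L M = valuation.lead_class (ring_of L M) (val_ring L M)"
proof -
  interpret valuation "ring_of L M" "val_ring L M" by (rule valuation_ring_of[OF assms])
  show ?thesis by (simp add: fun_eq_iff rv_def lead_class_def max_ideal_eq[OF assms])
qed

text \<open>
  In the following formulas, variable 0 is the argument of the polynomial, variable 1 the scale,
  variable 2 is bound, variable 3 stands for 0, and the variables from 4 on stand for the
  coefficients, leading coefficient first.
\<close>

fun horner :: "('f, 'r) vlang \<Rightarrow> nat \<Rightarrow> 'f tm" where
  "horner L 0 = Var 3"
| "horner L (Suc n) = Fun (add_sym L) [Fun (mul_sym L) [horner L n, Var 0], Var (n + 4)]"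

lemma fv_horner: "fv_tm (horner L n) \<subseteq> {0} \<union> {3..<n + 4}"
  by (induction n) auto

lemma wf_horner: "valued_language L \<Longrightarrow> wf_tm L (horner L n)"
  by (induction n) (auto simp: valued_language_def)

text \<open>Induction over prefixes: each further coefficient is added after multiplying by
  \<open>x\<close>. Zero enters as the value of variable 3, since the language need not have a
  constant for it.\<close>

lemma tm_val_horner:
  assumes "ring (ring_of L M)" and "set p \<subseteq> universe M" and "x \<in> universe M"
    and "v 0 = x" and "v 3 = \<zero>\<^bsub>ring_of L M\<^esub>" and "\<And>j. j < length p \<Longrightarrow> v (j + 4) = p ! j"
    and "n \<le> length p"
  shows "tm_val M v (horner L n) = ring.eval (ring_of L M) (take n p) x"
  using assms(7)
proof (induction n)
  interpret ring "ring_of L M" by fact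
  case 0
  show ?case using assms by simp
next
  interpret ring "ring_of L M" by fact
  case (Suc n)
  have sub: "set (take n p) \<subseteq> carrier (ring_of L M)" "p ! n \<in> carrier (ring_of L M)"
    using assms(2) Suc.prems set_take_subset[of n p] by (auto simp: carrier_ring_of)
  have "eval (take (Suc n) p) x = eval (take n p) x \<otimes>\<^bsub>ring_of L M\<^esub> x \<oplus>\<^bsub>ring_of L M\<^esub> p ! n"
    using Suc.prems sub assms(3) eval_in_carrier[OF sub(1), of x]
    by (simp only: take_Suc_conv_app_nth Suc_le_eq) (subst eval_append, auto simp: carrier_ring_of)
  then show ?case using Suc assms by (simp add: ring_of_ops)
qed

text \<open>\<open>|p(x)| \<le> |z|\<close>\<close>

definition vmult_form :: "('f, 'r) vlang \<Rightarrow> nat \<Rightarrow> ('f, 'r) form" where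
  "vmult_form L n = Neg (All 2 (Neg (Conj (Rel (val_sym L) [Var 2])
     (Eq (horner L n) (Fun (mul_sym L) [Var 1, Var 2])))))"

lemma wf_vmult_form: "valued_language L \<Longrightarrow> wf_form L (vmult_form L n)"
  using wf_horner[of L n] by (auto simp: vmult_form_def valued_language_def)

lemma fv_vmult_form: "fv (vmult_form L n) = insert 1 (fv_tm (horner L n))"
  using fv_horner[of L n] by (auto simp: vmult_form_def)

lemma sat_vmult_form:
  "sat M v (vmult_form L n) \<longleftrightarrow>
     (\<exists>c\<in>val_ring L M. tm_val M v (horner L n) = fun_int M (mul_sym L) [v 1, c])"
proof -
  have "tm_val M (v(2 := c)) (horner L n) = tm_val M v (horner L n)" for c
    by (rule tm_val_cong) (use fv_horner[of L n] in auto)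
  then show ?thesis by (auto simp: vmult_form_def val_ring_def)
qed

text \<open>That the ultrapower is a valued field is assumed here; it will be supplied by
  \<open>zero_h_minimal\<close>, which asserts it for every model.\<close>

locale valued_ultrapower = ultrapower L K F cls
  for L :: "('f, 'r) vlang" and K :: "('f, 'r, 'a) struct"
    and F :: "'i filter" and cls :: "('i \<Rightarrow> 'a) \<Rightarrow> 'u" +
  assumes lang: "valued_language L" and vf_K: "valued_field L K" and vf_upow: "valued_field L upow"
begin

sublocale K: valuation "ring_of L K" "val_ring L K"
  by (rule valuation_ring_of[OF vf_K])

sublocale U: valuation "ring_of L upow" "val_ring L upow"
  by (rule valuation_ring_of[OF vf_upow])

section \<open>Arithmetic and valuation of the ultrapower in terms of sequences\<close>

lemma mult_cls:
  assumes "g \<in> seqs K" "h \<in> seqs K"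
  shows "cls g \<otimes>\<^bsub>ring_of L upow\<^esub> cls h = cls (\<lambda>i. g i \<otimes>\<^bsub>ring_of L K\<^esub> h i)"
proof -
  have "x \<in> seqs K" if "x \<in> set [g, h]" for x using that assms by auto
  with lang show ?thesis
    using fun_int_upow[of "[g, h]" "mul_sym L" "\<lambda>x. x"]
    by (simp add: valued_language_def ring_of_ops)
qed

lemma add_cls:
  assumes "g \<in> seqs K" "h \<in> seqs K"
  shows "cls g \<oplus>\<^bsub>ring_of L upow\<^esub> cls h = cls (\<lambda>i. g i \<oplus>\<^bsub>ring_of L K\<^esub> h i)"
proof -
  have "x \<in> seqs K" if "x \<in> set [g, h]" for x using that assms by auto
  with lang show ?thesis
    using fun_int_upow[of "[g, h]" "add_sym L" "\<lambda>x. x"]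
    by (simp add: valued_language_def ring_of_ops)
qed

lemma seqs_carrier: "g \<in> seqs K \<longleftrightarrow> (\<forall>i. g i \<in> carrier (ring_of L K))"
  by (simp add: seqs_def carrier_ring_of)

lemma cls_carrier: "g \<in> seqs K \<Longrightarrow> cls g \<in> carrier (ring_of L upow)"
  by (simp add: carrier_ring_of)

text \<open>\<open>one\<close> is given by a description, not by a symbol, so it is identified
  algebraically: the class of the constant 1, multiplied by the unit of the ultrapower, is that unit
  by a componentwise computation.\<close>

lemma one_cls: "cls (\<lambda>_. \<one>\<^bsub>ring_of L K\<^esub>) = \<one>\<^bsub>ring_of L upow\<^esub>"
proof -
  obtain g where g: "g \<in> seqs K" "\<one>\<^bsub>ring_of L upow\<^esub> = cls g"
    using U.one_closed by (auto simp: carrier_ring_of)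
  have o: "(\<lambda>_. \<one>\<^bsub>ring_of L K\<^esub>) \<in> seqs K" using K.one_closed by (simp add: seqs_carrier)
  have "cls (\<lambda>_. \<one>\<^bsub>ring_of L K\<^esub>) \<otimes>\<^bsub>ring_of L upow\<^esub> \<one>\<^bsub>ring_of L upow\<^esub> = \<one>\<^bsub>ring_of L upow\<^esub>"
    unfolding g(2) mult_cls[OF o g(1)] using g(1) K.l_one by (simp only: seqs_carrier)
  then show ?thesis using U.r_one[OF cls_carrier[OF o]] by simp
qed

text \<open>Subtraction need not be a symbol either. The componentwise difference \<open>w\<close>
  added to \<open>h\<close> gives \<open>g\<close>, and cancellation in the ultrapower identifies
  its class.\<close>

lemma minus_cls:
  assumes "g \<in> seqs K" "h \<in> seqs K"
  shows "cls g \<ominus>\<^bsub>ring_of L upow\<^esub> cls h = cls (\<lambda>i. g i \<ominus>\<^bsub>ring_of L K\<^esub> h i)"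
proof -
  define w where "w = (\<lambda>i. g i \<ominus>\<^bsub>ring_of L K\<^esub> h i)"
  have w: "w \<in> seqs K"
    using assms K.minus_closed unfolding seqs_carrier w_def by blast
  have "w i \<oplus>\<^bsub>ring_of L K\<^esub> h i = g i" for i
  proof -
    have "g i \<in> carrier (ring_of L K)" "h i \<in> carrier (ring_of L K)"
      using assms by (auto simp only: seqs_carrier)
    then show ?thesis unfolding w_def by algebra
  qed
  then have *: "cls g = cls w \<oplus>\<^bsub>ring_of L upow\<^esub> cls h"
    unfolding add_cls[OF w assms(2)] by (simp only:)
  have "cls w \<in> carrier (ring_of L upow)" "cls h \<in> carrier (ring_of L upow)"
    using w assms cls_carrier by blast+
  then have "(cls w \<oplus>\<^bsub>ring_of L upow\<^esub> cls h) \<ominus>\<^bsub>ring_of L upow\<^esub> cls h = cls w"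
    by algebra
  then show ?thesis unfolding * by (simp only: w_def)
qed

lemma val_ring_cls:
  assumes "g \<in> seqs K"
  shows "cls g \<in> val_ring L upow \<longleftrightarrow> eventually (\<lambda>i. g i \<in> val_ring L K) F"
  using los_theorem[of "\<lambda>_. g" "Rel (val_sym L) [Var 0]"] assms lang
  by (simp add: valued_language_def val_ring_def seqs_def)

text \<open>An inverse of \<open>cls g\<close> in the valuation ring would be represented by a
  sequence in \<open>val_ring L K\<close> that is inverse to \<open>g\<close> at almost all
  indices.\<close>

lemma nonunits_cls:
  assumes "g \<in> seqs K" and "eventually (\<lambda>i. g i \<in> K.nonunits) F"
  shows "cls g \<in> U.nonunits"
  unfolding U.nonunits_def
proof (intro CollectI conjI ballI notI)
  show "cls g \<in> val_ring L upow"
    unfolding val_ring_cls[OF assms(1)] using assms(2) by (rule eventually_mono) (rule K.nonunits_V)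
next
  fix c assume c: "c \<in> val_ring L upow" "cls g \<otimes>\<^bsub>ring_of L upow\<^esub> c = \<one>\<^bsub>ring_of L upow\<^esub>"
  have "c \<in> universe upow" using c by (simp add: val_ring_def)
  then obtain h where h: "h \<in> seqs K" "c = cls h" by auto
  have gh: "(\<lambda>i. g i \<otimes>\<^bsub>ring_of L K\<^esub> h i) \<in> seqs K"
    using assms(1) h(1) K.m_closed unfolding seqs_carrier by blast
  have o: "(\<lambda>_. \<one>\<^bsub>ring_of L K\<^esub>) \<in> seqs K" using K.one_closed by (simp add: seqs_carrier)
  have "eventually (\<lambda>i. g i \<otimes>\<^bsub>ring_of L K\<^esub> h i = \<one>\<^bsub>ring_of L K\<^esub>) F"
    using c(2) unfolding h(2) mult_cls[OF assms(1) h(1)] one_cls[symmetric] cls_eq_iff[OF gh o] .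
  moreover have "eventually (\<lambda>i. h i \<in> val_ring L K) F"
    using c(1) h val_ring_cls by simp
  ultimately have "eventually (\<lambda>i. False) F"
    using assms(2) by eventually_elim (auto simp only: K.nonunits_def)
  then show False using ultra_F by (simp add: ultra_def)
qed

lemma diag_carrier: "a \<in> universe K \<Longrightarrow> diag a \<in> universe upow"
  by (simp add: diag_def seqs_def)

end

section \<open>Preparation at a pseudo-limit\<close>

text \<open>Of the ultrafilter only \<open>close\<close> is required beyond the locale. The
  preparing set cannot tell \<open>cls \<delta>\<close> from a suitable \<open>diag y\<close>,
  although \<open>D\<close> contains the first and not the second.\<close>

lemma (in valued_ultrapower) no_pseudo_limit_without_root:
  assumes hensel: "hensel_datum (ring_of L K) (val_ring L K) p a"
    and nz: "\<And>x. x \<in> hensel_datum.ball (ring_of L K) (val_ring L K) a \<Longrightarrow> K.eval p x \<noteq> \<zero>\<^bsub>ring_of L K\<^esub>"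
    and \<delta>: "\<And>i. \<delta> i \<in> hensel_datum.ball (ring_of L K) (val_ring L K) a"
    and close: "\<And>y. y \<in> hensel_datum.ball (ring_of L K) (val_ring L K) a \<Longrightarrow>
      eventually (\<lambda>i. \<delta> i \<in> hensel_datum.closer (ring_of L K) (val_ring L K) p a y) F"
    and prep: "\<And>A D. A \<subseteq> universe upow \<Longrightarrow> definable L upow (elements A \<union> RV L upow) D \<Longrightarrow>
      \<exists>C. definable L upow (elements A) C \<and> one_prepares L upow C D"
  shows False
proof -
  interpret H: hensel_datum "ring_of L K" "val_ring L K" p a by (rule hensel)
  let ?n = "length p"
  have p_K: "set p \<subseteq> universe K"
    using H.set_p K.V_carrier unfolding carrier_ring_of by blast
  have \<delta>_seq: "\<delta> \<in> seqs K"
    unfolding seqs_carrier using \<delta> H.ball_V K.V_carrier by blast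
  define z where "z i = K.eval p (\<delta> i)" for i
  have z: "z \<in> seqs K"
    unfolding seqs_carrier z_def using \<delta> H.ball_V H.eval_p_V K.V_carrier by blast
  \<comment> \<open>The parameters from \<open>K\<close>: zero for variable 3 and the coefficients
    from variable 4 on. The default zero keeps all other variables inside the universe.\<close>
  define k where "k j = (if 4 \<le> j \<and> j < ?n + 4 then p ! (j - 4) else \<zero>\<^bsub>ring_of L K\<^esub>)" for j
  have k: "k j \<in> universe K" for j
  proof (cases "4 \<le> j \<and> j < ?n + 4")
    case True
    then have "p ! (j - 4) \<in> set p" by (intro nth_mem) auto
    with True show ?thesis using p_K by (auto simp: k_def)
  next
    case False
    then show ?thesis using K.zero_closed unfolding k_def carrier_ring_of by auto
  qed
  have k3: "k 3 = \<zero>\<^bsub>ring_of L K\<^esub>" and k4: "j < ?n \<Longrightarrow> k (j + 4) = p ! j" for j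
    by (auto simp: k_def)
  let ?\<phi> = "vmult_form L ?n"
  define w where "w j = (if j = 1 then cls z else diag (k j))" for j
  define D where "D = {x \<in> universe upow. sat upow (w(0 := x)) ?\<phi>}"
  have zU: "cls z \<in> carrier (ring_of L upow)" by (rule cls_carrier[OF z])

  \<comment> \<open>Los's theorem turns membership in \<open>D\<close> into |p(g i)| \<le>
    |p(\<delta> i)| for almost all \<open>i\<close>.\<close>
  have D_iff: "cls g \<in> D \<longleftrightarrow> eventually (\<lambda>i. \<exists>c\<in>val_ring L K.
      K.eval p (g i) = z i \<otimes>\<^bsub>ring_of L K\<^esub> c) F" if g: "g \<in> seqs K" for g
  proof -
    define v where "v j = (if j = 0 then g else if j = 1 then z else (\<lambda>_. k j))" for j :: nat
    have v: "v j \<in> seqs K" for j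
      using g z k by (simp add: v_def seqs_def)
    have "w(0 := cls g) = (\<lambda>j. cls (v j))"
      by (auto simp: w_def v_def diag_def)
    then have "cls g \<in> D \<longleftrightarrow> sat upow (\<lambda>j. cls (v j)) ?\<phi>"
      using g by (simp add: D_def)
    also have "\<dots> \<longleftrightarrow> eventually (\<lambda>i. sat K (\<lambda>j. v j i) ?\<phi>) F"
      by (rule los_theorem[OF v wf_vmult_form[OF lang]])
    also have "(\<lambda>i. sat K (\<lambda>j. v j i) ?\<phi>)
        = (\<lambda>i. \<exists>c\<in>val_ring L K. K.eval p (g i) = z i \<otimes>\<^bsub>ring_of L K\<^esub> c)"
    proof
      fix i
      have "tm_val K (\<lambda>j. v j i) (horner L ?n) = K.eval (take ?n p) (g i)"
        by (rule tm_val_horner[OF K.ring_axioms p_K])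
          (use g k3 k4 in \<open>auto simp: v_def seqs_def\<close>)
      then show "sat K (\<lambda>j. v j i) ?\<phi> \<longleftrightarrow>
          (\<exists>c\<in>val_ring L K. K.eval p (g i) = z i \<otimes>\<^bsub>ring_of L K\<^esub> c)"
        by (simp add: sat_vmult_form v_def ring_of_ops)
    qed
    finally show ?thesis .
  qed

  have "definable L upow (elements (diag ` universe K) \<union> RV L upow) D"
    unfolding definable_def
  proof (intro exI conjI ballI allI impI)
    show "wf_form L ?\<phi>" by (rule wf_vmult_form[OF lang])
    \<comment> \<open>Variable 1 receives the imaginary parameter rv(p(\<delta>)), all others
      ordinary elements; so only the representative chosen for variable 1 can vary.\<close>
    define q where "q j = (if j = 1 then rv L upow (cls z) else {diag (k j)})" for j :: nat
    show "q j \<in> elements (diag ` universe K) \<union> RV L upow" if "j \<in> fv ?\<phi> - {0}" for j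
      using k z by (auto simp: q_def elements_def RV_def)
    fix v assume v: "\<forall>j\<in>fv ?\<phi> - {0}. v j \<in> q j"
    have "1 \<in> fv ?\<phi> - {0}" by (simp add: fv_vmult_form)
    with v have "v 1 \<in> q 1" by blast
    then have "v 1 \<in> U.lead_class (cls z)"
      by (simp add: q_def rv_eq[OF vf_upow])
    then obtain t where t: "t \<in> U.nonunits" "v 1 = cls z \<otimes>\<^bsub>ring_of L upow\<^esub> (\<one>\<^bsub>ring_of L upow\<^esub> \<oplus>\<^bsub>ring_of L upow\<^esub> t)"
      unfolding U.lead_class_iff by blast
    \<comment> \<open>Any representative is \<open>cls z\<close> times a unit \<open>u\<close>,
      hence has the same multiples by elements of the valuation ring.\<close>
    define u where "u = \<one>\<^bsub>ring_of L upow\<^esub> \<oplus>\<^bsub>ring_of L upow\<^esub> t"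
    have u: "u \<in> U.vunits" unfolding u_def by (rule U.vunits_add_nonunits[OF U.one_vunits t(1)])
    then obtain u' where u': "u' \<in> val_ring L upow" "u \<otimes>\<^bsub>ring_of L upow\<^esub> u' = \<one>\<^bsub>ring_of L upow\<^esub>"
      unfolding U.vunits_iff by blast
    have uc: "u \<in> carrier (ring_of L upow)" "u' \<in> carrier (ring_of L upow)"
      using u u' by auto
    have "sat upow (v(0 := x)) ?\<phi> \<longleftrightarrow> sat upow (w(0 := x)) ?\<phi>" for x
    proof -
      have "tm_val upow (v(0 := x)) (horner L ?n) = tm_val upow (w(0 := x)) (horner L ?n)"
      proof (rule tm_val_cong)
        fix j assume j: "j \<in> fv_tm (horner L ?n)"
        then have "j \<noteq> 1" using fv_horner[of L ?n] by auto
        then show "(v(0 := x)) j = (w(0 := x)) j"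
          using j bspec[OF v, of j] by (auto simp: fv_vmult_form q_def w_def)
      qed
      moreover have "(\<exists>c\<in>val_ring L upow. s = v 1 \<otimes>\<^bsub>ring_of L upow\<^esub> c)
          \<longleftrightarrow> (\<exists>c\<in>val_ring L upow. s = cls z \<otimes>\<^bsub>ring_of L upow\<^esub> c)" for s
      proof
        assume "\<exists>c\<in>val_ring L upow. s = v 1 \<otimes>\<^bsub>ring_of L upow\<^esub> c"
        then obtain c where c: "c \<in> val_ring L upow" "s = v 1 \<otimes>\<^bsub>ring_of L upow\<^esub> c" by blast
        then have "s = cls z \<otimes>\<^bsub>ring_of L upow\<^esub> (u \<otimes>\<^bsub>ring_of L upow\<^esub> c)"
          unfolding t(2) u_def[symmetric] using U.m_assoc[OF zU uc(1) U.V_carrier[OF c(1)]] by simp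
        moreover have "u \<otimes>\<^bsub>ring_of L upow\<^esub> c \<in> val_ring L upow" using u c by simp
        ultimately show "\<exists>c\<in>val_ring L upow. s = cls z \<otimes>\<^bsub>ring_of L upow\<^esub> c" by blast
      next
        assume "\<exists>c\<in>val_ring L upow. s = cls z \<otimes>\<^bsub>ring_of L upow\<^esub> c"
        then obtain c where c: "c \<in> val_ring L upow" "s = cls z \<otimes>\<^bsub>ring_of L upow\<^esub> c" by blast
        have cc: "c \<in> carrier (ring_of L upow)" using c by simp
        have "v 1 \<otimes>\<^bsub>ring_of L upow\<^esub> (u' \<otimes>\<^bsub>ring_of L upow\<^esub> c)
            = cls z \<otimes>\<^bsub>ring_of L upow\<^esub> ((u \<otimes>\<^bsub>ring_of L upow\<^esub> u') \<otimes>\<^bsub>ring_of L upow\<^esub> c)"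
          unfolding t(2) u_def[symmetric] using zU uc cc by (simp add: U.m_assoc)
        then have "s = v 1 \<otimes>\<^bsub>ring_of L upow\<^esub> (u' \<otimes>\<^bsub>ring_of L upow\<^esub> c)"
          unfolding u'(2) c(2) using cc by simp
        moreover have "u' \<otimes>\<^bsub>ring_of L upow\<^esub> c \<in> val_ring L upow" using u' c by simp
        ultimately show "\<exists>c\<in>val_ring L upow. s = v 1 \<otimes>\<^bsub>ring_of L upow\<^esub> c" by blast
      qed
      ultimately show ?thesis
        by (simp add: sat_vmult_form ring_of_ops w_def)
    qed
    then show "D = {x \<in> universe upow. sat upow (v(0 := x)) ?\<phi>}"
      by (simp add: D_def)
  qed
  moreover have "diag ` universe K \<subseteq> universe upow" using diag_carrier by blast
  ultimately obtain C where C: "definable L upow (elements (diag ` universe K)) C" "one_prepares L upow C D"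
    using prep by blast
  then obtain S where S: "finite S" "S \<subseteq> universe K" "C = diag ` S"
    using finite_definable_diag[OF C(1) order_refl] by (auto simp: one_prepares_def)

  \<comment> \<open>As \<open>S\<close> is finite, one index serves all its elements in the ball.
    The value of \<open>\<delta>\<close> there is the point \<open>y\<close> of \<open>K\<close> to
    be compared with \<open>cls \<delta>\<close>.\<close>
  have "eventually (\<lambda>i. \<forall>c\<in>S \<inter> H.ball. \<delta> i \<in> H.closer c) F"
    using S(1) close by (auto intro: eventually_ball_finite)
  then obtain i0 where i0: "\<forall>c\<in>S \<inter> H.ball. \<delta> i0 \<in> H.closer c"
    using ultra_F eventually_happens unfolding ultra_def by blast
  define y where "y = \<delta> i0"
  have y: "y \<in> H.ball" "y \<in> universe K" "(\<lambda>_. y) \<in> seqs K"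
    using \<delta> \<delta>_seq by (auto simp: y_def seqs_def)
  have near: "eventually (\<lambda>i. \<delta> i \<in> H.closer y) F" by (rule close[OF y(1)])

  have "rv L upow (cls \<delta> \<ominus>\<^bsub>ring_of L upow\<^esub> c) = rv L upow (diag y \<ominus>\<^bsub>ring_of L upow\<^esub> c)"
    if cC: "c \<in> C" for c
  proof -
    obtain s where s: "s \<in> S" "c = cls (\<lambda>_. s)" using cC unfolding S(3) diag_def by blast
    have s_seq: "(\<lambda>_. s) \<in> seqs K" using s S(2) by (auto simp: seqs_def)
    have sK: "s \<in> carrier (ring_of L K)" using s S(2) by (auto simp: carrier_ring_of)
    \<comment> \<open>Zero serves as a default where \<open>\<delta> i\<close> is not in
      \<open>closer y\<close>, so that \<open>t\<close> is a nonunit at every index.\<close>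
    have "\<exists>t. t \<in> K.nonunits \<and> (\<delta> i \<in> H.closer y \<longrightarrow>
        y \<ominus>\<^bsub>ring_of L K\<^esub> \<delta> i = (\<delta> i \<ominus>\<^bsub>ring_of L K\<^esub> s) \<otimes>\<^bsub>ring_of L K\<^esub> t)" for i
      using H.closer_diff_less[of "\<delta> i" y s] y(1) sK s i0 K.zero_nonunits unfolding y_def[symmetric] by blast
    then obtain t where t: "\<And>i. t i \<in> K.nonunits" "\<And>i. \<delta> i \<in> H.closer y \<Longrightarrow>
        y \<ominus>\<^bsub>ring_of L K\<^esub> \<delta> i = (\<delta> i \<ominus>\<^bsub>ring_of L K\<^esub> s) \<otimes>\<^bsub>ring_of L K\<^esub> t i"
      by metis
    have t_seq: "t \<in> seqs K" unfolding seqs_carrier using t(1) K.nonunits_V K.V_carrier by blast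
    define e where "e i = \<delta> i \<ominus>\<^bsub>ring_of L K\<^esub> s" for i
    define o' where "o' i = \<one>\<^bsub>ring_of L K\<^esub> \<oplus>\<^bsub>ring_of L K\<^esub> t i" for i
    have e: "e \<in> seqs K" unfolding seqs_carrier e_def
      using \<delta>_seq sK K.minus_closed unfolding seqs_carrier by blast
    have o': "o' \<in> seqs K" unfolding seqs_carrier o'_def
      using t_seq K.one_closed K.a_closed unfolding seqs_carrier by blast
    have one: "(\<lambda>_. \<one>\<^bsub>ring_of L K\<^esub>) \<in> seqs K" using K.one_closed by (simp add: seqs_carrier)
    \<comment> \<open>The displacement from \<open>\<delta> i\<close> to \<open>y\<close> is small
      compared with \<open>e i\<close>, so it is absorbed into the one-unit
      \<open>o' i\<close>.\<close>
    have "y \<ominus>\<^bsub>ring_of L K\<^esub> s = e i \<otimes>\<^bsub>ring_of L K\<^esub> o' i" if "\<delta> i \<in> H.closer y" for i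
    proof -
      have c: "y \<in> carrier (ring_of L K)" "\<delta> i \<in> carrier (ring_of L K)" "t i \<in> carrier (ring_of L K)"
        using y(3) \<delta>_seq t_seq by (auto simp only: seqs_carrier)
      have "y \<ominus>\<^bsub>ring_of L K\<^esub> s = (\<delta> i \<ominus>\<^bsub>ring_of L K\<^esub> s) \<oplus>\<^bsub>ring_of L K\<^esub> (y \<ominus>\<^bsub>ring_of L K\<^esub> \<delta> i)"
        using c sK by algebra
      also have "\<dots> = (\<delta> i \<ominus>\<^bsub>ring_of L K\<^esub> s) \<otimes>\<^bsub>ring_of L K\<^esub> (\<one>\<^bsub>ring_of L K\<^esub> \<oplus>\<^bsub>ring_of L K\<^esub> t i)"
        unfolding t(2)[OF that] using c sK by algebra
      finally show ?thesis by (simp only: e_def o'_def)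
    qed
    then have ev: "eventually (\<lambda>i. y \<ominus>\<^bsub>ring_of L K\<^esub> s = e i \<otimes>\<^bsub>ring_of L K\<^esub> o' i) F"
      using near by (auto elim: eventually_mono)
    have yK: "y \<in> carrier (ring_of L K)" using y(2) by (simp add: carrier_ring_of)
    have "(\<lambda>_ :: 'i. y \<ominus>\<^bsub>ring_of L K\<^esub> s) \<in> seqs K"
      unfolding seqs_carrier using K.minus_closed[OF yK sK] by simp
    moreover have "(\<lambda>i. e i \<otimes>\<^bsub>ring_of L K\<^esub> o' i) \<in> seqs K"
      using e o' unfolding seqs_carrier by (intro allI K.m_closed) auto
    ultimately have "cls (\<lambda>_. y \<ominus>\<^bsub>ring_of L K\<^esub> s) = cls (\<lambda>i. e i \<otimes>\<^bsub>ring_of L K\<^esub> o' i)"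
      using ev by (intro cls_eq_iff[THEN iffD2])
    then have "diag y \<ominus>\<^bsub>ring_of L upow\<^esub> c = cls e \<otimes>\<^bsub>ring_of L upow\<^esub> cls o'"
      unfolding s(2) diag_def minus_cls[OF y(3) s_seq] mult_cls[OF e o'] .
    also have "cls o' = \<one>\<^bsub>ring_of L upow\<^esub> \<oplus>\<^bsub>ring_of L upow\<^esub> cls t"
      unfolding one_cls[symmetric] add_cls[OF one t_seq] by (simp only: o'_def[abs_def])
    finally have eq: "diag y \<ominus>\<^bsub>ring_of L upow\<^esub> c
        = cls e \<otimes>\<^bsub>ring_of L upow\<^esub> (\<one>\<^bsub>ring_of L upow\<^esub> \<oplus>\<^bsub>ring_of L upow\<^esub> cls t)" .
    have "cls \<delta> \<ominus>\<^bsub>ring_of L upow\<^esub> c = cls e"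
      unfolding s(2) minus_cls[OF \<delta>_seq s_seq] by (simp only: e_def[abs_def])
    moreover have "cls t \<in> U.nonunits" using nonunits_cls[OF t_seq] t(1) by simp
    ultimately show ?thesis
      unfolding eq rv_eq[OF vf_upow] using U.lead_class_mult_one_add cls_carrier[OF e] by simp
  qed
  moreover have "cls \<delta> \<in> universe upow" "diag y \<in> universe upow"
    using \<delta>_seq diag_carrier[OF y(2)] by auto
  ultimately have "cls \<delta> \<in> D \<longleftrightarrow> diag y \<in> D"
    using C(2) unfolding one_prepares_def by blast
  moreover have "cls \<delta> \<in> D"
  proof -
    have "K.eval p (\<delta> i) = z i \<otimes>\<^bsub>ring_of L K\<^esub> \<one>\<^bsub>ring_of L K\<^esub>" for i
      using K.r_one[of "z i"] z unfolding seqs_carrier by (simp add: z_def)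
    then show ?thesis
      unfolding D_iff[OF \<delta>_seq] using K.V_closed(2) by (intro always_eventually) blast
  qed
  \<comment> \<open>If \<open>diag y\<close> were in \<open>D\<close>, p(y) would be a multiple of
    p(\<delta> i) within the valuation ring, while p(\<delta> i) is p(y) times a nonunit. Cancelling
    p(y), which is nonzero by \<open>nz\<close>, makes that nonunit invertible.\<close>
  ultimately have "eventually (\<lambda>i. \<exists>c\<in>val_ring L K. K.eval p y = z i \<otimes>\<^bsub>ring_of L K\<^esub> c) F"
    using D_iff[OF y(3)] by (simp add: diag_def)
  with near have "eventually (\<lambda>i. False) F"
  proof eventually_elim
    case (elim i)
    then obtain c t where ct: "c \<in> val_ring L K" "K.eval p y = z i \<otimes>\<^bsub>ring_of L K\<^esub> c"
      "t \<in> K.nonunits" "z i = K.eval p y \<otimes>\<^bsub>ring_of L K\<^esub> t"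
      unfolding H.closer_def z_def by blast
    define e where "e = K.eval p y"
    have e: "e \<in> carrier (ring_of L K)" "e \<noteq> \<zero>\<^bsub>ring_of L K\<^esub>" "c \<in> carrier (ring_of L K)" "t \<in> carrier (ring_of L K)"
      using nz[OF y(1)] y(1) ct(1,3) by (auto simp: e_def)
    have "e = (e \<otimes>\<^bsub>ring_of L K\<^esub> t) \<otimes>\<^bsub>ring_of L K\<^esub> c" using ct(2) unfolding ct(4) e_def .
    then have "e \<otimes>\<^bsub>ring_of L K\<^esub> (t \<otimes>\<^bsub>ring_of L K\<^esub> c) = e \<otimes>\<^bsub>ring_of L K\<^esub> \<one>\<^bsub>ring_of L K\<^esub>"
      using e by (simp add: K.m_assoc)
    then have "t \<otimes>\<^bsub>ring_of L K\<^esub> c = \<one>\<^bsub>ring_of L K\<^esub>"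
      using e K.m_lcancel[of e "t \<otimes>\<^bsub>ring_of L K\<^esub> c" "\<one>\<^bsub>ring_of L K\<^esub>"] by simp
    then show False using ct(1,3) unfolding K.nonunits_def by blast
  qed
  then show False using ultra_F by (simp add: ultra_def)
qed

section \<open>Hensel's lemma from preparation in an ultrapower\<close>

theorem theorem2p7p2:
  fixes L :: "('f, 'r) vlang" and K :: "('f, 'r, 'a) struct"
  assumes "valued_language L"
    and "is_structure L K"
    and "equichar0_valued_field L K"
    and "zero_h_minimal TYPE(('f, 'r, 'a) model_universe) L (theory_of L K)"
  shows "henselian L K"
  unfolding henselian_def
proof (intro conjI ballI impI)
  show vf: "valued_field L K" using assms(3) by (simp add: equichar0_valued_field_def)
  interpret K: valuation "ring_of L K" "val_ring L K" by (rule valuation_ring_of[OF vf])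
  fix p a
  assume p: "p \<in> carrier (univ_poly (ring_of L K) (val_ring L K))" and a: "a \<in> val_ring L K"
    and *: "val_less L K (K.eval p a) \<one>\<^bsub>ring_of L K\<^esub> \<and>
        val_eq L K (K.eval (poly_deriv (ring_of L K) p) a) \<one>\<^bsub>ring_of L K\<^esub>"
  have sub: "set p \<subseteq> val_ring L K"
    using p by (auto simp: univ_poly_def polynomial_def)
  have "K.eval p a \<in> universe K" "K.eval (poly_deriv (ring_of L K) p) a \<in> universe K"
    using K.eval_closed_subring[OF K.subring_V _ a] sub K.set_poly_deriv[OF K.subring_V sub] K.V_carrier
    unfolding carrier_ring_of by blast+
  with * have "K.eval p a \<in> K.nonunits" "K.eval (poly_deriv (ring_of L K) p) a \<in> K.vunits"
    by (simp_all add: val_less_one_iff[OF vf] val_eq_one_iff[OF vf])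
  with a sub interpret H: hensel_datum "ring_of L K" "val_ring L K" p a
    by unfold_locales
  have "\<exists>b\<in>H.ball. K.eval p b = \<zero>\<^bsub>ring_of L K\<^esub>"
  proof (rule ccontr)
    assume "\<not> ?thesis"
    then have nz: "\<And>x. x \<in> H.ball \<Longrightarrow> K.eval p x \<noteq> \<zero>\<^bsub>ring_of L K\<^esub>" by blast
    \<comment> \<open>The filter generated by the sets \<open>H.closer y\<close>. By
      \<open>H.closer_chain\<close> they form a base, and by \<open>H.newton\<close> none is empty,
      so \<open>B\<close> is proper.\<close>
    define B where "B = (INF y\<in>H.ball. principal (H.closer y))"
    have B: "eventually P B \<longleftrightarrow> (\<exists>y\<in>H.ball. \<forall>x\<in>H.closer y. P x)" for P
      unfolding B_def
    proof (subst eventually_INF_base)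
      show "\<exists>x\<in>H.ball. principal (H.closer x) \<le> inf (principal (H.closer y)) (principal (H.closer y'))"
        if "y \<in> H.ball" "y' \<in> H.ball" for y y'
        using H.closer_chain[OF that nz[OF that(1)] nz[OF that(2)]] that by auto
    qed (use H.a_ball in \<open>auto simp: eventually_principal\<close>)
    then have "B \<noteq> bot"
      using H.newton by (auto simp: trivial_limit_def)
    then obtain F where F: "F \<le> B" "ultra F" by (rule ultrafilter_exists)
    obtain cls :: "('a \<Rightarrow> 'a) \<Rightarrow> ('f, 'r, 'a) model_universe"
      where cls: "\<And>g h. cls g = cls h \<longleftrightarrow> eventually (\<lambda>i. g i = h i) F"
      using ultrapower_class_map[of F] by blast
    interpret ultrapower L K F cls
      by unfold_locales (use assms(2) F cls in auto)
    \<comment> \<open>The ultrapower is a model of \<open>theory_of L K\<close> in the type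
      \<open>model_universe\<close>, so \<open>zero_h_minimal\<close> applies to it.\<close>
    have vf': "valued_field L upow"
      and prep: "\<And>A D. A \<subseteq> universe upow \<Longrightarrow> definable L upow (elements A \<union> RV L upow) D \<Longrightarrow>
        \<exists>C. definable L upow (elements A) C \<and> one_prepares L upow C D"
      using assms(4) is_model_upow unfolding zero_h_minimal_def equichar0_valued_field_def by blast+
    interpret valued_ultrapower L K F cls
      by unfold_locales (use assms(1) vf vf' in auto)
    show False
    proof (rule no_pseudo_limit_without_root[OF H.hensel_datum_axioms nz])
      \<comment> \<open>The identity on the index set, redirected to \<open>a\<close> outside the
        ball so that all values lie in the ball. On each \<open>H.closer y\<close>, a subset of the
        ball, nothing changes.\<close>
      let ?\<delta> = "\<lambda>x. if x \<in> H.ball then x else a"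
      show "?\<delta> i \<in> H.ball" for i using H.a_ball by simp
      show "eventually (\<lambda>i. ?\<delta> i \<in> H.closer y) F" if "y \<in> H.ball" for y
      proof (rule filter_leD[OF F(1)])
        show "eventually (\<lambda>i. ?\<delta> i \<in> H.closer y) B"
          unfolding B using that H.closer_ball[of y] by auto
      qed
    qed (use prep in auto)
  qed
  then obtain b where b: "b \<in> H.ball" "K.eval p b = \<zero>\<^bsub>ring_of L K\<^esub>" by blast
  then have "val_less L K (b \<ominus>\<^bsub>ring_of L K\<^esub> a) \<one>\<^bsub>ring_of L K\<^esub>"
    using val_less_one_iff[OF vf] K.V_carrier[OF K.nonunits_V] H.ball_minus[OF b(1)]
    unfolding carrier_ring_of by blast
  with b show "\<exists>b\<in>val_ring L K. K.eval p b = \<zero>\<^bsub>ring_of L K\<^esub> \<and>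
      val_less L K (b \<ominus>\<^bsub>ring_of L K\<^esub> a) \<one>\<^bsub>ring_of L K\<^esub>"
    using H.ball_V by blast
qed

end
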